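(* Let $E$ be a finite or countable space equipped with the trivial distance $d(x,y)=\mathbf{1}_{x\neq y}$, let $N\geq1$, let $(P_{xy})_{x,y\in E}$ be a stochastic matrix and, for each $x\in E$, let $c^{\rm zr}_x:\mathbb{N}\to\mathbb{R}_+$ be a non-negative function, where $\mathbb{N}=\{1,2,\ldots\}$. Consider the (non-explosive) zero range particle system on $E^N$ with infinitesimal generator $$\mathcal{L}^{\rm zr} f(\bar{x})=\sum_{i=1}^N c^{\rm zr}_{x_i}(\eta^{\bar x}_{x_i})\sum_{y\in E} P_{x_iy}\bigl(f(x_1,\ldots,x_{i-1},y,x_{i+1},\ldots,x_N)-f(\bar x)\bigr),$$ where $\eta^{\bar x}_x=\sum_{i=1}^N \mathbf{1}_{x_i=x}$ is the number of components of $\bar x$ equal to $x$. Then the coarse Ricci curvature $\sigma^{\rm zr}$ of this particle system satisfies $$\sigma^{\rm zr}\geq \inf_{x, y\in E,\ n,m\in \mathbb{N}} \theta_P(x,y)\, \bigl(c^{\rm zr}_x(n)\wedge c^{\rm zr}_y(m)\bigr)-2\sup_{x\in E,\ n,m\in\mathbb{N}} (1-P_{xx})\frac{n}{m}\bigl|c^{\rm zr}_x(n)-c^{\rm zr}_x(n+m)\bigr|.$$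
   Context: $E^N$ is endowed with $d(\bar x,\bar y)=\frac1N\sum_{i=1}^N d(x_i,y_i)$. $a\wedge b=\min(a,b)$. $\theta_P(x,y)$ is the discrete-time coarse Ricci curvature of $P$ along $(x,y)$, $\theta_P(x,y)=1-\mathcal{W}_d(P_x,P_y)/d(x,y)$ where $P_x=(P_{xz})_{z\in E}$; since $d$ is the trivial distance it is given by $\theta_P(x,y)=1-\frac12\|P_x-P_y\|_{TV}$, with $\|P_x-P_y\|_{TV}=\sum_{z\in E}|P_{xz}-P_{yz}|$ (this formula is used for all $x,y$, so $\theta_P(x,x)=1$). The coarse Ricci curvature of a Markov process $\bar X$ on $E^N$ is the largest $\sigma\in[-\infty,+\infty]$ such that, for all $t\geq0$ and all $\bar x,\bar y\in E^N$, $\mathcal{W}_d\bigl(\mathbb{P}(\bar X_t\in\cdot\mid\bar X_0=\bar x),\mathbb{P}(\bar X_t\in\cdot\mid\bar X_0=\bar y)\bigr)\leq e^{-\sigma t}d(\bar x,\bar y)$, where $\mathcal{W}_d(\mu,\nu)=\inf_\pi\int d\,d\pi$ is the Wasserstein distance (infimum over couplings $\pi$ of $\mu$ and $\nu$). *)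

theory Defs
  imports "HOL-Probability.Probability"
begin

section \<open>Distances\<close>

definition trivial_dist :: "'a \<Rightarrow> 'a \<Rightarrow> real" where
  "trivial_dist x y = (if x \<noteq> y then 1 else 0)"

text \<open>Elements of \<open>E\<^sup>N\<close> are functions from a finite index type \<open>'n\<close> to \<open>E\<close>, so \<open>N = CARD('n) \<ge> 1\<close>.\<close>

definition mean_dist :: "('a \<Rightarrow> 'a \<Rightarrow> real) \<Rightarrow> ('n::finite \<Rightarrow> 'a) \<Rightarrow> ('n \<Rightarrow> 'a) \<Rightarrow> real" where
  "mean_dist d x y = (1 / real CARD('n)) * (\<Sum>i\<in>UNIV. d (x i) (y i))"

definition couplings :: "'s pmf \<Rightarrow> 's pmf \<Rightarrow> ('s \<times> 's) pmf set" where
  "couplings \<mu> \<nu> = {\<pi>. map_pmf fst \<pi> = \<mu> \<and> map_pmf snd \<pi> = \<nu>}"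

definition wasserstein :: "('s \<Rightarrow> 's \<Rightarrow> real) \<Rightarrow> 's pmf \<Rightarrow> 's pmf \<Rightarrow> ennreal" where
  "wasserstein d \<mu> \<nu> =
     (INF \<pi>\<in>couplings \<mu> \<nu>. \<integral>\<^sup>+ z. ennreal (d (fst z) (snd z)) \<partial>measure_pmf \<pi>)"

section \<open>Coarse Ricci curvature\<close>

text \<open>A stochastic matrix on a countable space is a family of pmfs: \<open>P\<^sub>x\<^sub>y = pmf (P x) y\<close>.
  For the trivial distance, the value below is \<open>1 - (\<Sum>z. \<bar>P\<^sub>x\<^sub>z - P\<^sub>y\<^sub>z\<bar>) / 2\<close>. This includes
  \<open>x = y\<close>, where both are \<open>1\<close>, since \<open>d x x = 0\<close> and division by zero yields zero.\<close>

definition coarse_ricci_along ::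
    "('s \<Rightarrow> 's \<Rightarrow> real) \<Rightarrow> ('s \<Rightarrow> 's pmf) \<Rightarrow> 's \<Rightarrow> 's \<Rightarrow> real" where
  "coarse_ricci_along d P x y = 1 - enn2real (wasserstein d (P x) (P y)) / d x y"

text \<open>In continuous time, \<open>p t x\<close> is the law of \<open>X\<^sub>t\<close> given \<open>X\<^sub>0 = x\<close>. Taking the supremum in the
  extended reals over real \<open>\<sigma>\<close> gives the largest admissible \<open>\<sigma> \<in> [-\<infinity>, +\<infinity>]\<close>:
  the condition is closed and monotone in \<open>\<sigma>\<close>, the value \<open>-\<infinity>\<close> is always admissible (and is the
  supremum of the empty set), and \<open>+\<infinity>\<close> is admissible iff every real \<open>\<sigma>\<close> is.\<close>

definition coarse_ricci ::
    "('s \<Rightarrow> 's \<Rightarrow> real) \<Rightarrow> (real \<Rightarrow> 's \<Rightarrow> 's pmf) \<Rightarrow> ereal" where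
  "coarse_ricci d p =
     Sup {ereal \<sigma> | \<sigma>. \<forall>t\<ge>0. \<forall>x y.
            wasserstein d (p t x) (p t y) \<le> ennreal (exp (- \<sigma> * t) * d x y)}"

section \<open>Markov processes with a given generator on a countable space\<close>

definition markov_semigroup :: "(real \<Rightarrow> 's \<Rightarrow> 's pmf) \<Rightarrow> bool" where
  "markov_semigroup p \<longleftrightarrow>
     (\<forall>x. p 0 x = return_pmf x) \<and>
     (\<forall>s\<ge>0. \<forall>t\<ge>0. \<forall>x. p (s + t) x = bind_pmf (p s x) (p t))"

definition has_generator ::
    "(real \<Rightarrow> 's \<Rightarrow> 's pmf) \<Rightarrow> (('s \<Rightarrow> real) \<Rightarrow> 's \<Rightarrow> real) \<Rightarrow> bool" where
  "has_generator p L \<longleftrightarrow>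
     (\<forall>f x. bounded (range f) \<longrightarrow>
        ((\<lambda>t. measure_pmf.expectation (p t x) f) has_real_derivative L f x) (at_right 0))"

text \<open>The jump rate from \<open>x\<close> to \<open>y \<noteq> x\<close> and the total exit rate from \<open>x\<close>, for a generator
  \<open>L f x = (\<Sum>y. q x y * (f y - f x))\<close>.\<close>

definition jump_rate :: "(('s \<Rightarrow> real) \<Rightarrow> 's \<Rightarrow> real) \<Rightarrow> 's \<Rightarrow> 's \<Rightarrow> real" where
  "jump_rate L x y = L (indicator {y}) x"

definition exit_rate :: "(('s \<Rightarrow> real) \<Rightarrow> 's \<Rightarrow> real) \<Rightarrow> 's \<Rightarrow> real" where
  "exit_rate L x = - L (indicator {x}) x"

text \<open>For \<open>t \<ge> 0\<close>, \<open>jump_time_cdf L n t x\<close> is the probability that the jump process started at \<open>x\<close>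
  has its \<open>n\<close>-th jump at or before time \<open>t\<close>. The recursion conditions on the first jump:
  it takes place at time \<open>s\<close> and leads to \<open>y\<close> with density \<open>exp (- q x * s) * q x y\<close>, after
  which the process starts afresh from \<open>y\<close>.\<close>

primrec jump_time_cdf ::
    "(('s \<Rightarrow> real) \<Rightarrow> 's \<Rightarrow> real) \<Rightarrow> nat \<Rightarrow> real \<Rightarrow> 's \<Rightarrow> ennreal" where
  "jump_time_cdf L 0 t x = 1"
| "jump_time_cdf L (Suc n) t x =
     (\<integral>\<^sup>+ s\<in>{0..t}.
        (\<integral>\<^sup>+ y. ennreal (exp (- exit_rate L x * s) * jump_rate L x y) * jump_time_cdf L n (t - s) y
           \<partial>count_space (UNIV - {x})) \<partial>lborel)"

text \<open>The jump times tend to infinity almost surely, from every initial state. Since they increase,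
  this amounts to their distribution functions tending to zero pointwise.\<close>

definition nonexplosive :: "(('s \<Rightarrow> real) \<Rightarrow> 's \<Rightarrow> real) \<Rightarrow> bool" where
  "nonexplosive L \<longleftrightarrow> (\<forall>t\<ge>0. \<forall>x. (\<lambda>n. jump_time_cdf L n t x) \<longlonglongrightarrow> 0)"

section \<open>The zero range particle system\<close>

definition occupation :: "('n::finite \<Rightarrow> 'a) \<Rightarrow> 'a \<Rightarrow> nat" where
  "occupation x a = card {i. x i = a}"

definition zr_generator ::
    "('a \<Rightarrow> nat \<Rightarrow> real) \<Rightarrow> ('a \<Rightarrow> 'a pmf) \<Rightarrow> (('n::finite \<Rightarrow> 'a) \<Rightarrow> real) \<Rightarrow> ('n \<Rightarrow> 'a) \<Rightarrow> real" where
  "zr_generator c P f x =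
     (\<Sum>i\<in>UNIV. c (x i) (occupation x (x i)) *
        (\<Sum>\<^sub>\<infinity>y. pmf (P (x i)) y * (f (x(i := y)) - f x)))"

end

theory Submission
  imports Defs
begin

text \<open>
  Couple two copies of the particle system componentwise: the \<open>i\<close>-th particles jump together, at
  the smaller of their two rates and by a nearly optimal coupling of the two rows of \<open>P\<close>; at the
  excess rate the faster one jumps alone. Unmatched pairs are thereby matched at rate at least the
  infimum. A matched pair at \<open>v\<close> splits at a rate proportional to the difference of the rates at the
  two occupation numbers of \<open>v\<close>; summing over the pairs at \<open>v\<close> gives at most the supremum times the
  difference of the occupation numbers, and these differences add up to at most twice the number of
  unmatched pairs. Hence the distance has drift at most \<open>- \<sigma>\<close> times itself.

  The rates may be unbounded, so the passage from the drift to the semigroup uses the minimal coupled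
  process, constructed by iterating its backward integral equation. Its mass and its marginals are
  controlled by the same equation: the marginals are dominated by the given semigroup, and no mass
  is lost because the coupled process cannot make infinitely many moves unless one of its
  components does.
\<close>

section \<open>Convolution with an exponential\<close>

text \<open>Here \<open>u\<close> is the time left after the first move, so \<open>t - u\<close> is
  the waiting time. Values in \<open>ennreal\<close> spare all integrability questions when rates
  are unbounded.\<close>

definition exp_conv :: "real \<Rightarrow> (real \<Rightarrow> ennreal) \<Rightarrow> real \<Rightarrow> ennreal" where
  "exp_conv r v t = (\<integral>\<^sup>+u\<in>{0..t}. ennreal (exp (- r * (t - u))) * v u \<partial>lborel)"

lemma measurable_exp_conv [measurable]:
  assumes [measurable]: "v \<in> borel_measurable borel"
  shows "exp_conv r v \<in> borel_measurable borel"
proof -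
  have eq: "exp_conv r v = (\<lambda>t. \<integral>\<^sup>+u. ennreal (exp (- r * (t - u))) * v u * (if 0 \<le> u \<and> u
      \<le> t then 1 else 0) \<partial>lborel)"
    by (auto simp: exp_conv_def fun_eq_iff indicator_def intro!: nn_integral_cong)
  show ?thesis
    unfolding eq by measurable
qed

lemma exp_conv_mono:
  "(\<And>u. 0 \<le> u \<Longrightarrow> u \<le> t \<Longrightarrow> v u \<le> w u) \<Longrightarrow> exp_conv r v t \<le> exp_conv r w t"
  unfolding exp_conv_def by (intro nn_integral_mono) (auto split: split_indicator intro: mult_left_mono)

lemma exp_conv_add:
  assumes [measurable]: "v \<in> borel_measurable borel" "w \<in> borel_measurable borel"
  shows "exp_conv r (\<lambda>u. v u + w u) t = exp_conv r v t + exp_conv r w t"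
  unfolding exp_conv_def
  by (subst nn_integral_add[symmetric]) (auto simp: distrib_left distrib_right)

lemma exp_conv_cmult:
  assumes [measurable]: "v \<in> borel_measurable borel"
  shows "exp_conv r (\<lambda>u. a * v u) t = a * exp_conv r v t"
  unfolding exp_conv_def
  by (subst nn_integral_cmult[symmetric]) (auto simp: ac_simps)

text \<open>The integrand is the derivative in \<open>u\<close> of
  \<open>exp (- r * (t - u)) * exp (- s * u)\<close>, and \<open>s \<le> r\<close> keeps it
  nonnegative. This makes exponentials usable as comparison functions for the integral equations
  below.\<close>

lemma exp_conv_exp:
  assumes "s \<le> r" "0 \<le> t"
  shows "exp_conv r (\<lambda>u. ennreal ((r - s) * exp (- s * u))) t = ennreal (exp (- s * t) - exp (- r * t))"
proof -
  have "exp_conv r (\<lambda>u. ennreal ((r - s) * exp (- s * u))) t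
      = (\<integral>\<^sup>+u. ennreal (exp (- r * (t - u)) * ((r - s) * exp (- s * u))) * indicator {0..t} u \<partial>lborel)"
    unfolding exp_conv_def using assms by (simp add: ennreal_mult)
  also have "\<dots> = ennreal (exp (- r * (t - t)) * exp (- s * t) - exp (- r * (t - 0)) * exp (- s * 0))"
    using assms
    by (intro nn_integral_FTC_Icc)
       (auto intro!: derivative_eq_intros simp: algebra_simps)
  finally show ?thesis by simp
qed

lemma exp_conv_const:
  assumes "0 \<le> r" "0 \<le> t"
  shows "exp_conv r (\<lambda>u. ennreal r * a) t = ennreal (1 - exp (- r * t)) * a"
proof -
  have "exp_conv r (\<lambda>u. a * ennreal r) t = a * exp_conv r (\<lambda>u. ennreal ((r - 0) * exp (- 0 * u))) t"
    by (subst exp_conv_cmult) auto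
  also have "\<dots> = a * ennreal (1 - exp (- r * t))"
    using assms exp_conv_exp[of 0 r t] by simp
  finally show ?thesis by (simp add: mult.commute)
qed

text \<open>Waiting at rate \<open>s\<close> is the same as waiting at a faster rate \<open>r\<close> with dummy jumps at rate \<open>r - s\<close>.\<close>

lemma exp_conv_resolvent:
  assumes sr: "s \<le> r" and t: "0 \<le> t" and v[measurable]: "v \<in> borel_measurable borel"
  shows "exp_conv r (\<lambda>u. v u + ennreal (r - s) * exp_conv s v u) t = exp_conv s v t"
proof -
  \<comment> \<open>Convolution identity for the two exponential kernels, pointwise in
    \<open>w\<close>. Once the integrals are exchanged by Fubini, the claim reduces to it.\<close>
  have *: "ennreal (exp (- r * (t - w))) + (\<integral>\<^sup>+u. ennreal ((r - s) * exp (- r * (t - u)) * exp (- s * (u - w)))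
        * (if w \<le> u \<and> u \<le> t then 1 else 0) \<partial>lborel)
      = ennreal (exp (- s * (t - w)))" if "0 \<le> w" "w \<le> t" for w
  proof -
    have "(\<integral>\<^sup>+u. ennreal ((r - s) * exp (- r * (t - u)) * exp (- s * (u - w))) * indicator {w..t} u \<partial>lborel)
       = ennreal (exp (- r * (t - t)) * exp (- s * (t - w)) - exp (- r * (t - w)) * exp (- s * (w - w)))"
      using sr that
      by (intro nn_integral_FTC_Icc)
         (auto intro!: derivative_eq_intros simp: algebra_simps)
    moreover have "exp (- r * (t - w)) \<le> exp (- s * (t - w))"
      using sr that by (simp add: mult_right_mono)
    ultimately show ?thesis
      by (simp add: indicator_def of_bool_def flip: ennreal_plus)
  qed
  have "exp_conv r (\<lambda>u. ennreal (r - s) * exp_conv s v u) t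
    = (\<integral>\<^sup>+u. \<integral>\<^sup>+w. ennreal (exp (- r * (t - u))) *
        (ennreal (r - s) * (ennreal (exp (- s * (u - w))) * v w
        * (if 0 \<le> w \<and> w \<le> u \<and> u \<le> t then 1 else 0))) \<partial>lborel \<partial>lborel)"
    unfolding exp_conv_def
    by (subst nn_integral_cmult[symmetric] nn_integral_multc[symmetric], measurable)+
       (auto intro!: nn_integral_cong simp: indicator_def)
  also have "\<dots> = (\<integral>\<^sup>+w. \<integral>\<^sup>+u. ennreal (exp (- r * (t - u))) *
        (ennreal (r - s) * (ennreal (exp (- s * (u - w))) * v w
        * (if 0 \<le> w \<and> w \<le> u \<and> u \<le> t then 1 else 0))) \<partial>lborel \<partial>lborel)"
    by (rule lborel_pair.Fubini') measurable
  also have "\<dots> = (\<integral>\<^sup>+w. (\<integral>\<^sup>+u. ennreal ((r - s) * exp (- r * (t - u)) * exp (- s * (u - w)))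
        * (if w \<le> u \<and> u \<le> t then 1 else 0) \<partial>lborel) * (v w * indicator {0..t} w) \<partial>lborel)"
    using sr
    apply (intro nn_integral_cong)
    apply (subst nn_integral_multc[symmetric])
     apply simp
    apply (rule nn_integral_cong)
    apply (auto simp: indicator_def ennreal_mult ac_simps)
    done
  finally have eq: "exp_conv r (\<lambda>u. ennreal (r - s) * exp_conv s v u) t = \<dots>" .
  have F_meas: "(\<lambda>w. \<integral>\<^sup>+u. ennreal ((r - s) * exp (- r * (t - u)) * exp (- s * (u - w)))
        * (if w \<le> u \<and> u \<le> t then 1 else 0) \<partial>lborel)
      \<in> borel_measurable lborel"
    by measurable
  have "exp_conv r (\<lambda>u. v u + ennreal (r - s) * exp_conv s v u) t
    = exp_conv r v t + exp_conv r (\<lambda>u. ennreal (r - s) * exp_conv s v u) t"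
    by (rule exp_conv_add) auto
  also have "\<dots> = (\<integral>\<^sup>+w. ennreal (exp (- s * (t - w))) * v w * indicator {0..t} w \<partial>lborel)"
    unfolding eq unfolding exp_conv_def
    apply (subst nn_integral_add[symmetric])
    subgoal by measurable
    subgoal by (intro borel_measurable_times_ennreal F_meas) measurable
    apply (intro nn_integral_cong)
    subgoal for w
      using *[of w] by (auto split: split_indicator simp flip: distrib_right)
    done
  finally show ?thesis unfolding exp_conv_def .
qed

text \<open>The generator yields only right derivatives, so the mean value theorem does not apply.
  Instead, the set of points at which \<open>f\<close> lies in the cone of slope \<open>e\<close> at
  \<open>a\<close> is compact, and its maximum must be \<open>b\<close>: at an earlier point the
  zero right derivative produces a later member.\<close>

lemma right_derivative_zero_imp_constant:
  fixes f :: "real \<Rightarrow> real"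
  assumes ab: "a \<le> b" and cont: "continuous_on {a..b} f"
    and deriv: "\<And>t. a \<le> t \<Longrightarrow> t < b \<Longrightarrow> (f has_real_derivative 0) (at_right t)"
  shows "f b = f a"
proof -
  have bound: "\<bar>f b - f a\<bar> \<le> e * (b - a)" if e: "0 < e" for e
  proof -
    define S where "S = {t \<in> {a..b}. \<bar>f t - f a\<bar> \<le> e * (t - a)}"
    have "closed S"
      unfolding S_def
    proof (rule continuous_on_closed_Collect_le)
      show "continuous_on {a..b} (\<lambda>t. \<bar>f t - f a\<bar>)"
        by (intro continuous_on_rabs continuous_on_diff cont continuous_on_const)
      show "continuous_on {a..b} (\<lambda>t. e * (t - a))"
        by (intro continuous_intros)
    qed simp
    then have "compact ({a..b} \<inter> S)"
      by (intro compact_Int_closed compact_Icc)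
    also have "{a..b} \<inter> S = S"
      by (auto simp: S_def)
    finally have "compact S" .
    moreover have "a \<in> S" using ab by (simp add: S_def)
    ultimately obtain m where m: "m \<in> S" "\<And>t. t \<in> S \<Longrightarrow> t \<le> m"
      using compact_attains_sup[of S] by auto
    have "m = b"
    proof (rule ccontr)
      assume "m \<noteq> b"
      then have mb: "a \<le> m" "m < b" using m(1) by (auto simp: S_def)
      have "((\<lambda>y. (f y - f m) / (y - m)) \<longlongrightarrow> 0) (at_right m)"
        using deriv[OF mb] by (simp add: has_field_derivative_iff)
      then have "eventually (\<lambda>y. dist ((f y - f m) / (y - m)) 0 < e) (at_right m)"
        using e by (rule tendstoD)
      moreover have "eventually (\<lambda>y. y \<in> {m<..<b}) (at_right m)"
        by (rule eventually_at_right_real) fact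
      ultimately have "eventually (\<lambda>y. dist ((f y - f m) / (y - m)) 0 < e \<and> y \<in> {m<..<b}) (at_right m)"
        by eventually_elim auto
      then obtain y where y: "dist ((f y - f m) / (y - m)) 0 < e" "m < y" "y < b"
        by (metis (mono_tags, lifting) eventually_happens trivial_limit_at_right_real
            greaterThanLessThan_iff)
      then have "\<bar>f y - f m\<bar> \<le> e * (y - m)"
        by (simp add: abs_divide pos_divide_less_eq)
      moreover have "\<bar>f m - f a\<bar> \<le> e * (m - a)" using m(1) by (simp add: S_def)
      ultimately have "\<bar>f y - f a\<bar> \<le> e * (y - a)"
        by (simp add: algebra_simps)
      with y mb have "y \<in> S" by (simp add: S_def)
      with m(2)[of y] y show False by simp
    qed
    with m(1) show ?thesis by (simp add: S_def)
  qed
  show ?thesis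
  proof (cases "a = b")
    case False
    have "\<bar>f b - f a\<bar> \<le> 0"
    proof (rule field_le_epsilon)
      fix d :: real assume "0 < d"
      with bound[of "d / (b - a)"] ab False show "\<bar>f b - f a\<bar> \<le> 0 + d"
        by simp
    qed
    then show ?thesis by simp
  qed simp
qed

section \<open>The backward equation\<close>

lemma integrable_pmf_bounded:
  fixes f :: "'s \<Rightarrow> real"
  shows "bounded (range f) \<Longrightarrow> integrable (measure_pmf M) f"
  unfolding bounded_iff
  by (elim exE, rule_tac B = a in measure_pmf.integrable_const_bound) auto

lemma expectation_bind_pmf_bounded:
  fixes f :: "'s \<Rightarrow> real"
  assumes "bounded (range f)"
  shows "measure_pmf.expectation (bind_pmf M N) f = measure_pmf.expectation M (\<lambda>x.
      measure_pmf.expectation (N x) f)"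
proof -
  obtain B where "\<And>x. \<bar>f x\<bar> \<le> B"
    using assms by (auto simp: bounded_iff)
  then show ?thesis
    unfolding measure_pmf_bind
    by (intro integral_bind[where K = "count_space UNIV" and B = B and B' = 1])
       (auto simp: measure_pmf.emeasure_space_1 intro: measure_pmf.finite_measure_axioms
           measure_pmf_in_subprob_space)
qed

lemma abs_expectation_le:
  fixes f :: "'s \<Rightarrow> real"
  assumes "\<And>x. \<bar>f x\<bar> \<le> B"
  shows "\<bar>measure_pmf.expectation M f\<bar> \<le> B"
proof -
  have "integrable (measure_pmf M) f"
    using assms by (intro integrable_pmf_bounded) (auto simp: bounded_iff)
  then have "measure_pmf.expectation M f \<le> B" "- B \<le> measure_pmf.expectation M f"
    using assms measure_pmf.integral_le_const[of M f B] measure_pmf.integral_ge_const[of M f "- B"]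
    by (auto simp: abs_le_iff minus_le_iff)
  then show ?thesis by simp
qed

text \<open>Right differentiability at \<open>0\<close> of the probability of sitting at
  \<open>x\<close> entails right continuity there.\<close>

lemma semigroup_stay_tendsto_1:
  assumes "markov_semigroup p" "has_generator p L"
  shows "((\<lambda>s. pmf (p s x) x) \<longlongrightarrow> 1) (at_right 0)"
proof -
  have "bounded (range (\<lambda>y. indicator {x} y :: real))"
    by (auto simp: bounded_iff indicator_def intro!: exI[of _ 1])
  with assms have "((\<lambda>t. measure_pmf.expectation (p t x) (\<lambda>y. indicator {x} y))
      has_real_derivative L (\<lambda>y. indicator {x} y) x) (at_right 0)"
    by (auto simp: has_generator_def)
  then have "((\<lambda>t. pmf (p t x) x) has_real_derivative L (\<lambda>y. indicator {x} y) x) (at_right 0)"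
    by (simp add: pmf.rep_eq)
  then have "continuous (at_right 0) (\<lambda>t. pmf (p t x) x)"
    by (rule DERIV_continuous)
  then show ?thesis
    using assms by (simp add: continuous_within markov_semigroup_def)
qed

text \<open>Splitting off an initial piece of length \<open>s\<close>, the increment is at most
  \<open>2 * B\<close> times the probability of being away from \<open>x\<close> at time
  \<open>s\<close>. This is uniform in the base time, hence gives continuity from the left as
  well.\<close>

lemma continuous_on_semigroup:
  fixes f :: "'s \<Rightarrow> real"
  assumes p: "markov_semigroup p" "has_generator p L" and f: "bounded (range f)"
  shows "continuous_on {0..} (\<lambda>t. measure_pmf.expectation (p t x) f)"
proof -
  obtain B where B: "\<And>x. \<bar>f x\<bar> \<le> B"
    using f by (auto simp: bounded_iff)
  then have "0 \<le> B" by (metis abs_ge_zero order_trans)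
  define u where "u t y = measure_pmf.expectation (p t y) f" for t y
  have uB: "\<bar>u t y\<bar> \<le> B" for t y
    unfolding u_def using B by (rule abs_expectation_le)
  have incr: "\<bar>u (t + s) x - u t x\<bar> \<le> 2 * B * (1 - pmf (p s x) x)" if "0 \<le> s" "0 \<le> t" for s t
  proof -
    have bdd: "bounded (range (u t))"
      using uB by (auto simp: bounded_iff)
    have "u (t + s) x = measure_pmf.expectation (p s x) (u t)"
      using p(1) that f unfolding u_def markov_semigroup_def
      by (subst add.commute) (simp add: expectation_bind_pmf_bounded)
    then have "u (t + s) x - u t x = measure_pmf.expectation (p s x) (\<lambda>y. u t y - u t x)"
      using integrable_pmf_bounded[OF bdd] by simp
    also have "\<bar>\<dots>\<bar> \<le> measure_pmf.expectation (p s x) (\<lambda>y. \<bar>u t y - u t x\<bar>)"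
      by (rule integral_abs_bound)
    also have "\<dots> \<le> measure_pmf.expectation (p s x) (\<lambda>y. 2 * B * (1 - indicator {x} y))"
    proof (rule integral_mono)
      show "integrable (measure_pmf (p s x)) (\<lambda>y. \<bar>u t y - u t x\<bar>)"
        using integrable_pmf_bounded[OF bdd] by simp
      show "integrable (measure_pmf (p s x)) (\<lambda>y. 2 * B * (1 - indicator {x} y))"
        by (intro integrable_pmf_bounded) (auto simp: bounded_iff indicator_def intro!: exI[of _ "2 * \<bar>B\<bar>"])
      show "\<bar>u t y - u t x\<bar> \<le> 2 * B * (1 - indicator {x} y)" for y
        using uB[of t y] uB[of t x] by (auto simp: indicator_def)
    qed
    also have "\<dots> = 2 * B * (1 - pmf (p s x) x)"
      by (subst integral_mult_right_zero, subst Bochner_Integration.integral_diff)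
         (auto simp: pmf.rep_eq intro!: integrable_pmf_bounded
             simp: bounded_iff indicator_def of_bool_def intro!: exI[of _ 1])
    finally show ?thesis .
  qed
  have "((\<lambda>s. 2 * B * (1 - pmf (p s x) x)) \<longlongrightarrow> 2 * B * (1 - 1)) (at_right 0)"
    by (intro tendsto_intros semigroup_stay_tendsto_1[OF p])
  then have lim: "((\<lambda>s. 2 * B * (1 - pmf (p s x) x)) \<longlongrightarrow> 0) (at_right 0)"
    by simp
  show ?thesis
    unfolding u_def[symmetric] continuous_on_iff
  proof (intro ballI allI impI)
    fix t e :: real assume t: "t \<in> {0..}" and e: "0 < e"
    have "eventually (\<lambda>s. dist (2 * B * (1 - pmf (p s x) x)) 0 < e) (at_right 0)"
      using lim e by (rule tendstoD)
    then obtain d where d: "0 < d" "\<And>s. 0 < s \<Longrightarrow> s < d \<Longrightarrow> 2 * B * (1 - pmf (p s x) x) < e"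
      by (auto simp: eventually_at_right_field dest: abs_less_iff[THEN iffD1])
    have "dist (u t' x) (u t x) < e" if t': "t' \<in> {0..}" "dist t' t < d" for t'
    proof -
      consider "t' = t" | "t < t'" | "t' < t" by linarith
      then show ?thesis
      proof cases
        case 2
        with incr[of "t' - t" t] d(2)[of "t' - t"] t t' show ?thesis
          by (auto simp: dist_real_def)
      next
        case 3
        with incr[of "t - t'" t'] d(2)[of "t - t'"] t t' show ?thesis
          by (auto simp: dist_real_def)
      qed (use e in auto)
    qed
    with d(1) show "\<exists>d>0. \<forall>t'\<in>{0..}. dist t' t < d \<longrightarrow> dist (u t' x) (u t x) < e"
      by auto
  qed
qed

text \<open>Kolmogorov's backward equation in one-sided form: the semigroup property moves the
  increment to the start, where the generator acts on the bounded function
  \<open>\<lambda>y. measure_pmf.expectation (p t y) f\<close>.\<close>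

lemma semigroup_right_derivative:
  fixes f :: "'s \<Rightarrow> real"
  assumes p: "markov_semigroup p" "has_generator p L" and f: "bounded (range f)" and t: "0 \<le> t"
  shows "((\<lambda>s. measure_pmf.expectation (p s x) f) has_real_derivative
      L (\<lambda>y. measure_pmf.expectation (p t y) f) x) (at_right t)"
proof -
  define u where "u t y = measure_pmf.expectation (p t y) f" for t y
  obtain B where B: "\<And>x. \<bar>f x\<bar> \<le> B"
    using f by (auto simp: bounded_iff)
  have bdd: "bounded (range (u t))"
    using abs_expectation_le[of f B, OF B] by (auto simp: bounded_iff u_def)
  have eq: "u (s + t) x = measure_pmf.expectation (p s x) (u t)" if "0 \<le> s" for s
    using p(1) t that f unfolding u_def markov_semigroup_def
    by (simp add: expectation_bind_pmf_bounded)
  have "((\<lambda>s. measure_pmf.expectation (p s x) (u t)) has_real_derivative L (u t) x) (at_right 0)"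
    using p(2) bdd by (auto simp: has_generator_def)
  then have "((\<lambda>s. (u (s + t) x - u t x) / s) \<longlongrightarrow> L (u t) x) (at_right 0)"
    unfolding has_field_derivative_iff
    by (rule Lim_transform_eventually)
       (use eq[of 0] in \<open>auto simp: eventually_at_right_field eq intro!: exI[of _ 1]\<close>)
  then show ?thesis
    unfolding has_field_derivative_iff filterlim_at_right_to_0[of _ _ t] u_def[symmetric]
    by (simp add: add.commute)
qed

text \<open>Variation of constants for \<open>u' = r * (\<phi> - u)\<close>, where
  \<open>\<phi>\<close> averages \<open>u\<close> over \<open>K\<close>. The law \<open>K\<close>
  may charge \<open>x\<close>, so moves without effect are allowed; they occur when only the other
  component of a coupled pair moves.\<close>

lemma semigroup_backward_equation:
  fixes f :: "'s \<Rightarrow> real"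
  assumes p: "markov_semigroup p" "has_generator p L"
    and r: "0 \<le> r" and L: "\<And>f. bounded (range f) \<Longrightarrow> L f x = r * (measure_pmf.expectation K f - f x)"
    and f: "bounded (range f)" "\<And>y. 0 \<le> f y" and t: "0 \<le> t"
  shows "ennreal (measure_pmf.expectation (p t x) f) = ennreal (exp (- r * t)) * ennreal (f x) +
    exp_conv r (\<lambda>u. ennreal r * (\<integral>\<^sup>+y. ennreal (measure_pmf.expectation (p u y) f) \<partial>K)) t"
proof -
  define u where "u t y = measure_pmf.expectation (p t y) f" for t y
  obtain B where B: "\<And>x. \<bar>f x\<bar> \<le> B"
    using f by (auto simp: bounded_iff)
  have uB: "\<bar>u t y\<bar> \<le> B" for t y
    unfolding u_def using B by (rule abs_expectation_le)
  have bdd: "bounded (range (u t))" for t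
    using uB by (auto simp: bounded_iff)
  have u0: "u 0 x = f x"
    using p(1) by (simp add: u_def markov_semigroup_def)
  have u_nonneg: "0 \<le> u t y" for t y
    unfolding u_def using f by (intro integral_nonneg_AE) auto
  define \<phi> where "\<phi> t = measure_pmf.expectation K (u t)" for t
  have \<phi>_nonneg: "0 \<le> \<phi> t" for t
    unfolding \<phi>_def using u_nonneg by (intro integral_nonneg_AE) auto
  have cont_u: "continuous_on {0..} (\<lambda>t. u t y)" for y
    unfolding u_def by (rule continuous_on_semigroup[OF p f(1)])
  have cont_\<phi>: "continuous_on {0..} \<phi>"
  proof (rule continuous_on_sequentiallyI)
    fix X :: "nat \<Rightarrow> real" and t assume X: "\<forall>n. X n \<in> {0..}" "t \<in> {0..}" "X \<longlonglongrightarrow> t"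
    show "(\<lambda>n. \<phi> (X n)) \<longlonglongrightarrow> \<phi> t"
      unfolding \<phi>_def
    proof (rule integral_dominated_convergence[where w = "\<lambda>_. B"])
      show "AE y in K. (\<lambda>n. u (X n) y) \<longlonglongrightarrow> u t y"
        using X cont_u by (auto simp: continuous_on_sequentially o_def)
    qed (use uB in auto)
  qed
  \<comment> \<open>\<open>max 0 s\<close> here and the lower limit \<open>-1\<close> in
    \<open>\<Phi>\<close> continue the integral to the left of \<open>0\<close>, so that
    \<open>\<Phi>\<close> has a two-sided derivative at \<open>0\<close> too.\<close>
  define \<psi> where "\<psi> s = r * (exp (r * s) * \<phi> (max 0 s))" for s
  have cont_\<psi>: "continuous_on UNIV \<psi>"
    unfolding \<psi>_def
    by (intro continuous_intros continuous_on_compose2[OF cont_\<phi>]) auto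
  have \<psi>_nonneg: "0 \<le> \<psi> s" for s
    using r \<phi>_nonneg by (simp add: \<psi>_def)
  define \<Phi> where "\<Phi> s = integral {-1..s} \<psi>" for s
  have \<Phi>': "(\<Phi> has_real_derivative \<psi> s) (at s)" if "0 \<le> s" for s
  proof -
    have "(\<Phi> has_real_derivative \<psi> s) (at s within {-1..s + 1})"
      unfolding \<Phi>_def using that
      by (intro integral_has_real_derivative) (auto intro: continuous_on_subset[OF cont_\<psi>])
    then show ?thesis
      using that by (subst (asm) at_within_interior) (auto simp: interior_atLeastAtMost_real)
  qed
  have FTC: "(\<integral>\<^sup>+s. ennreal (\<psi> s) * indicator {0..t} s \<partial>lborel) = ennreal (\<Phi> t - \<Phi> 0)"
    using t \<Phi>' \<psi>_nonneg cont_\<psi>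
    by (intro nn_integral_FTC_Icc) (auto intro: borel_measurable_continuous_onI)
  \<comment> \<open>The integrating factor \<open>exp (r * s)\<close> turns the backward equation
    into constancy of \<open>G\<close>.\<close>
  define G where "G s = exp (r * s) * u s x - \<Phi> s" for s
  have "G t = G 0"
  proof (rule right_derivative_zero_imp_constant[OF t])
    have "continuous_on {0..t} \<Phi>"
      using \<Phi>' by (intro DERIV_continuous_on) (auto intro: DERIV_subset)
    then show "continuous_on {0..t} G"
      unfolding G_def using continuous_on_subset[OF cont_u]
      by (intro continuous_intros) auto
    fix s assume s: "0 \<le> s" "s < t"
    have "((\<lambda>s. u s x) has_real_derivative L (u s) x) (at_right s)"
      unfolding u_def by (rule semigroup_right_derivative[OF p f(1) s(1)])
    also have "L (u s) x = r * (\<phi> s - u s x)"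
      using L[OF bdd] by (simp add: \<phi>_def)
    finally have "((\<lambda>s. u s x) has_real_derivative r * (\<phi> s - u s x)) (at_right s)" .
    moreover have "(\<Phi> has_real_derivative \<psi> s) (at_right s)"
      using \<Phi>'[OF s(1)] by (rule DERIV_subset) simp
    ultimately show "(G has_real_derivative 0) (at_right s)"
      unfolding G_def using s
      by (auto intro!: derivative_eq_intros simp: \<psi>_def algebra_simps)
  qed
  then have "exp (r * t) * u t x = f x + (\<Phi> t - \<Phi> 0)"
    by (simp add: G_def u0)
  then have "exp (- r * t) * (exp (r * t) * u t x) = exp (- r * t) * (f x + (\<Phi> t - \<Phi> 0))"
    by simp
  then have ut: "u t x = exp (- r * t) * f x + exp (- r * t) * (\<Phi> t - \<Phi> 0)"
    by (simp add: exp_minus field_simps)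
  have \<Phi>_le: "\<Phi> 0 \<le> \<Phi> t"
    using t \<Phi>' \<psi>_nonneg by (intro DERIV_nonneg_imp_nondecreasing[OF t]) auto
  have "exp_conv r (\<lambda>s. ennreal r * (\<integral>\<^sup>+y. ennreal (u s y) \<partial>K)) t
      = (\<integral>\<^sup>+s. ennreal (exp (- r * t)) * (ennreal (\<psi> s) * indicator {0..t} s) \<partial>lborel)"
    unfolding exp_conv_def
  proof (rule nn_integral_cong)
    fix s
    have "(\<integral>\<^sup>+y. ennreal (u s y) \<partial>K) = ennreal (\<phi> s)"
      unfolding \<phi>_def using u_nonneg
      by (intro nn_integral_eq_integral integrable_pmf_bounded bdd) auto
    then show "ennreal (exp (- r * (t - s))) * (ennreal r * (\<integral>\<^sup>+y. ennreal (u s y) \<partial>K)) * indicator {0..t} s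
       = ennreal (exp (- r * t)) * (ennreal (\<psi> s) * indicator {0..t} s)"
      using r \<phi>_nonneg
      by (auto simp: \<psi>_def algebra_simps exp_add exp_diff exp_minus field_simps simp flip:
          ennreal_mult split: split_indicator)
  qed
  also have "\<dots> = ennreal (exp (- r * t)) * ennreal (\<Phi> t - \<Phi> 0)"
    using FTC borel_measurable_continuous_onI[OF cont_\<psi>] by (subst nn_integral_cmult) auto
  finally show ?thesis
    using f(2) \<Phi>_le by (simp add: ut ennreal_mult flip: u_def)
qed

section \<open>Jump times\<close>

lemma measurable_nn_integral_count_space:
  fixes V :: "real \<Rightarrow> 's::countable \<Rightarrow> ennreal"
  assumes V: "\<And>w. (\<lambda>u. V u w) \<in> borel_measurable borel"
  shows "(\<lambda>u. \<integral>\<^sup>+w. V u w \<partial>count_space A) \<in> borel_measurable borel"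
proof -
  interpret sigma_finite_measure "count_space A"
    by (rule sigma_finite_measure_count_space)
  have "(\<lambda>x. V (snd x) (fst x)) \<in> borel_measurable (count_space A \<Otimes>\<^sub>M borel)"
    by (rule measurable_pair_measure_countable1) (use V in auto)
  then have "case_prod V \<in> borel_measurable (borel \<Otimes>\<^sub>M count_space A)"
    by (subst measurable_pair_swap_iff) (simp add: case_prod_beta)
  then show ?thesis
    by (rule borel_measurable_nn_integral)
qed

lemma measurable_nn_integral_pmf:
  fixes V :: "real \<Rightarrow> 's::countable \<Rightarrow> ennreal"
  assumes [measurable]: "\<And>w. (\<lambda>u. V u w) \<in> borel_measurable borel"
  shows "(\<lambda>u. \<integral>\<^sup>+w. V u w \<partial>measure_pmf M) \<in> borel_measurable borel"
  unfolding nn_integral_measure_pmf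
  by (intro measurable_nn_integral_count_space) simp

lemma exp_conv_nn_integral_count_space:
  fixes v :: "real \<Rightarrow> 's::countable \<Rightarrow> ennreal"
  assumes [measurable]: "\<And>w. (\<lambda>u. v u w) \<in> borel_measurable borel"
  shows "exp_conv r (\<lambda>u. \<integral>\<^sup>+w. v u w \<partial>count_space UNIV) t
    = (\<integral>\<^sup>+w. exp_conv r (\<lambda>u. v u w) t \<partial>count_space UNIV)"
  unfolding exp_conv_def
  by (subst nn_integral_count_space_nn_integral[symmetric])
     (auto simp: nn_integral_cmult nn_integral_multc intro!: nn_integral_cong)

text \<open>Substituting \<open>t - s\<close> for the time \<open>s\<close> of the first jump brings
  the recursion into the same shape as the backward equation.\<close>

lemma jump_time_cdf_Suc_conv:
  fixes L :: "('s::countable \<Rightarrow> real) \<Rightarrow> 's \<Rightarrow> real"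
  assumes [measurable]: "\<And>y. (\<lambda>u. jump_time_cdf L n u y) \<in> borel_measurable borel"
  shows "jump_time_cdf L (Suc n) t x =
    exp_conv (exit_rate L x) (\<lambda>u. \<integral>\<^sup>+y. ennreal (jump_rate L x y)
        * jump_time_cdf L n u y \<partial>count_space (UNIV - {x})) t"
proof -
  define g where "g u = (\<integral>\<^sup>+y. ennreal (jump_rate L x y) * jump_time_cdf L n u y \<partial>count_space (UNIV
      - {x}))" for u
  have [measurable]: "g \<in> borel_measurable borel"
    unfolding g_def by (intro measurable_nn_integral_count_space) simp
  have "exp_conv (exit_rate L x) g t =
      (\<integral>\<^sup>+s. ennreal (exp (- exit_rate L x * s)) * g (t - s) * indicator {0..t} (t - s) \<partial>lborel)"
    unfolding exp_conv_def
    by (subst nn_integral_real_affine[where c = "-1" and t = t]) auto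
  also have "\<dots> = jump_time_cdf L (Suc n) t x"
    unfolding g_def jump_time_cdf.simps
    by (auto simp: ennreal_mult' nn_integral_cmult mult.assoc indicator_def intro!: nn_integral_cong)
  finally show ?thesis by (simp add: g_def[abs_def])
qed

lemma measurable_jump_time_cdf [measurable]:
  fixes L :: "('s::countable \<Rightarrow> real) \<Rightarrow> 's \<Rightarrow> real"
  shows "(\<lambda>t. jump_time_cdf L n t x) \<in> borel_measurable borel"
proof (induction n arbitrary: x)
  case (Suc n)
  note [measurable] = Suc.IH
  show ?case
    unfolding jump_time_cdf_Suc_conv[OF Suc.IH]
    by (intro measurable_exp_conv measurable_nn_integral_count_space) simp
qed simp

text \<open>\<open>jump_time_cdf\<close> counts genuine changes of state, whereas \<open>K\<close>
  may contain moves from \<open>x\<close> to \<open>x\<close>; after such a move all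
  \<open>Suc n\<close> jumps are still to come. These moves are absorbed by
  \<open>exp_conv_resolvent\<close>.\<close>

lemma jump_time_cdf_Suc_pmf:
  fixes L :: "('s::countable \<Rightarrow> real) \<Rightarrow> 's \<Rightarrow> real"
  assumes r: "0 \<le> r" and L: "\<And>f. bounded (range f) \<Longrightarrow> L f x = r * (measure_pmf.expectation K f - f x)"
    and t: "0 \<le> t"
  shows "exp_conv r (\<lambda>u. ennreal r *
      (\<integral>\<^sup>+y. (if y = x then jump_time_cdf L (Suc n) u x else jump_time_cdf L n u y) \<partial>K)) t
    = jump_time_cdf L (Suc n) t x"
proof -
  \<comment> \<open>The genuine exit rate; the rest, \<open>r - q = r * pmf K x\<close>, is the rate
    of moves from \<open>x\<close> to \<open>x\<close>.\<close>
  define q where "q = r * (1 - pmf K x)"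
  have L_ind: "L (indicator {y}) x = r * (pmf K y - indicator {y} x)" for y
    by (subst L) (auto simp: bounded_iff indicator_def pmf.rep_eq intro!: exI[of _ 1])
  have exit: "exit_rate L x = q"
    by (simp add: exit_rate_def L_ind q_def algebra_simps)
  have jump: "jump_rate L x y = r * pmf K y" if "y \<noteq> x" for y
    using that by (simp add: jump_rate_def L_ind)
  define g where "g u = (\<integral>\<^sup>+y. ennreal (jump_rate L x y) * jump_time_cdf L n u y \<partial>count_space (UNIV
      - {x}))" for u
  have [measurable]: "g \<in> borel_measurable borel"
    unfolding g_def by (intro measurable_nn_integral_count_space) simp
  have conv: "jump_time_cdf L (Suc n) u x = exp_conv q g u" for u
    by (subst jump_time_cdf_Suc_conv) (simp_all add: exit g_def[abs_def])
  have qr: "q \<le> r"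
    using r by (simp add: q_def mult_left_le pmf_le_1)
  have "ennreal r * (\<integral>\<^sup>+y. (if y = x then A else h y) \<partial>K)
      = (\<integral>\<^sup>+y. ennreal (jump_rate L x y) * h y \<partial>count_space (UNIV - {x})) + ennreal (r - q) * A"
    for A and h :: "'s \<Rightarrow> ennreal"
  proof -
    have "(\<integral>\<^sup>+y. (if y = x then A else h y) \<partial>K) = (\<integral>\<^sup>+y. h y * indicator (UNIV - {x}) y
        + A * indicator {x} y \<partial>K)"
      by (intro nn_integral_cong) (auto simp: indicator_def)
    also have "\<dots> = (\<integral>\<^sup>+y. h y * indicator (UNIV - {x}) y \<partial>K) + A * ennreal (pmf K x)"
      by (subst nn_integral_add) (auto simp: nn_integral_cmult emeasure_pmf_single)
    also have "(\<integral>\<^sup>+y. h y * indicator (UNIV - {x}) y \<partial>K) = (\<integral>\<^sup>+y. ennreal (pmf K y)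
        * h y \<partial>count_space (UNIV - {x}))"
      unfolding nn_integral_measure_pmf by (subst (2) nn_integral_count_space_indicator) (auto
          simp: mult.assoc)
    finally have "ennreal r * (\<integral>\<^sup>+y. (if y = x then A else h y) \<partial>K)
       = (\<integral>\<^sup>+y. ennreal r * (ennreal (pmf K y) * h y) \<partial>count_space (UNIV - {x}))
           + ennreal r * ennreal (pmf K x) * A"
      by (simp add: distrib_left nn_integral_cmult ac_simps)
    also have "(\<integral>\<^sup>+y. ennreal r * (ennreal (pmf K y) * h y) \<partial>count_space (UNIV - {x}))
       = (\<integral>\<^sup>+y. ennreal (jump_rate L x y) * h y \<partial>count_space (UNIV - {x}))"
      using r by (intro nn_integral_cong) (auto simp: jump ennreal_mult mult.assoc)
    also have "ennreal r * ennreal (pmf K x) = ennreal (r - q)"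
      using r by (simp add: q_def ennreal_mult algebra_simps flip: ennreal_mult)
    finally show ?thesis .
  qed
  then have "exp_conv r (\<lambda>u. ennreal r *
      (\<integral>\<^sup>+y. (if y = x then jump_time_cdf L (Suc n) u x else jump_time_cdf L n u y) \<partial>K)) t
    = exp_conv r (\<lambda>u. g u + ennreal (r - q) * exp_conv q g u) t"
    by (simp add: g_def flip: conv del: jump_time_cdf.simps)
  also have "\<dots> = exp_conv q g t"
    by (rule exp_conv_resolvent[OF qr t]) measurable
  finally show ?thesis by (simp only: conv)
qed

section \<open>Coupled jump processes\<close>

lemma ennreal_mult_INF_decseq:
  fixes a :: "nat \<Rightarrow> ennreal"
  assumes "c < top" "decseq a"
  shows "c * (INF n. a n) = (INF n. c * a n)"
proof (rule LIMSEQ_unique)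
  show "(\<lambda>n. c * a n) \<longlonglongrightarrow> c * (INF n. a n)"
    using assms by (intro ennreal_tendsto_cmult LIMSEQ_INF)
  show "(\<lambda>n. c * a n) \<longlonglongrightarrow> (INF n. c * a n)"
    using assms by (intro LIMSEQ_INF) (auto simp: decseq_def intro: mult_left_mono)
qed

text \<open>\<open>L_fst\<close> and \<open>L_snd\<close> make the pair process a coupling: seen
  through either component, a move at \<open>z\<close> reproduces the generator \<open>L\<close>.
  The rate depends on \<open>z\<close> and may be unbounded, which is where non-explosion of
  \<open>L\<close> enters.\<close>

locale jump_coupling =
  fixes p :: "real \<Rightarrow> 's::countable \<Rightarrow> 's pmf"
    and L :: "('s \<Rightarrow> real) \<Rightarrow> 's \<Rightarrow> real"
    and r :: "'s \<times> 's \<Rightarrow> real"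
    and R :: "'s \<times> 's \<Rightarrow> ('s \<times> 's) pmf"
  assumes semigroup: "markov_semigroup p"
    and generator: "has_generator p L"
    and nonexplosive: "nonexplosive L"
    and r_nonneg: "0 \<le> r z"
    and L_fst: "bounded (range f) \<Longrightarrow> L f (fst z) = r z * (measure_pmf.expectation (map_pmf fst (R z))
        f - f (fst z))"
    and L_snd: "bounded (range f) \<Longrightarrow> L f (snd z) = r z * (measure_pmf.expectation (map_pmf snd (R z))
        f - f (snd z))"
begin

text \<open>The coupled process waits at \<open>z\<close> at rate \<open>r z\<close> and then moves according to \<open>R z\<close>, possibly without
  changing its state. \<open>approx g n t z\<close> is the expectation of \<open>g\<close> at time \<open>t\<close> on the event that fewer than
  \<open>n\<close> moves have taken place, and \<open>defect n t z\<close> is the probability of the complement.\<close>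

definition conv :: "(real \<Rightarrow> 's \<times> 's \<Rightarrow> ennreal) \<Rightarrow> real \<Rightarrow> 's \<times> 's \<Rightarrow> ennreal" where
  "conv V t z = exp_conv (r z) (\<lambda>u. ennreal (r z) * (\<integral>\<^sup>+w. V u w \<partial>R z)) t"

primrec approx :: "('s \<times> 's \<Rightarrow> ennreal) \<Rightarrow> nat \<Rightarrow> real \<Rightarrow> 's \<times> 's \<Rightarrow> ennreal" where
  "approx g 0 t z = 0"
| "approx g (Suc n) t z = ennreal (exp (- r z * t)) * g z + conv (approx g n) t z"

primrec defect :: "nat \<Rightarrow> real \<Rightarrow> 's \<times> 's \<Rightarrow> ennreal" where
  "defect 0 t z = 1"
| "defect (Suc n) t z = conv (defect n) t z"

section \<open>Monotonicity, mass balance and linearity of the iteration\<close>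

lemma measurable_conv:
  "(\<And>w. (\<lambda>u. V u w) \<in> borel_measurable borel) \<Longrightarrow> (\<lambda>t. conv V t z) \<in> borel_measurable borel"
  unfolding conv_def
  by (intro measurable_exp_conv borel_measurable_times_ennreal measurable_nn_integral_pmf) auto

lemma measurable_approx [measurable]: "(\<lambda>t. approx g n t z) \<in> borel_measurable borel"
  by (induction n arbitrary: z) (auto intro!: borel_measurable_add measurable_conv)

lemma measurable_defect [measurable]: "(\<lambda>t. defect n t z) \<in> borel_measurable borel"
  by (induction n arbitrary: z) (auto intro!: measurable_conv)

lemma conv_mono: "(\<And>u w. 0 \<le> u \<Longrightarrow> u \<le> t \<Longrightarrow> V u w \<le> W u w) \<Longrightarrow> conv V t z \<le> conv W t z"
  unfolding conv_def by (intro exp_conv_mono mult_left_mono nn_integral_mono) auto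

lemma conv_cong: "(\<And>u w. 0 \<le> u \<Longrightarrow> u \<le> t \<Longrightarrow> V u w = W u w) \<Longrightarrow> conv V t z = conv W t z"
  by (intro antisym conv_mono) auto

lemma conv_add:
  assumes "\<And>w. (\<lambda>u. V u w) \<in> borel_measurable borel" "\<And>w. (\<lambda>u. W u w) \<in> borel_measurable borel"
  shows "conv (\<lambda>u w. V u w + W u w) t z = conv V t z + conv W t z"
  using assms unfolding conv_def
  by (simp add: nn_integral_add distrib_left exp_conv_add measurable_nn_integral_pmf)

lemma conv_const: "0 \<le> t \<Longrightarrow> conv (\<lambda>_ _. a) t z = ennreal (1 - exp (- r z * t)) * a"
  unfolding conv_def by (simp add: exp_conv_const r_nonneg measure_pmf.emeasure_space_1)

lemma approx_mono: "approx g n t z \<le> approx g (Suc n) t z"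
  by (induction n arbitrary: t z) (auto intro!: add_left_mono conv_mono)

lemma approx_incseq: "incseq (\<lambda>n. approx g n t z)"
  by (intro incseq_SucI approx_mono)

lemma defect_antimono: "0 \<le> t \<Longrightarrow> defect (Suc n) t z \<le> defect n t z"
proof (induction n arbitrary: t z)
  case 0
  have "defect 0 = (\<lambda>_ _. 1)" by (simp add: fun_eq_iff)
  with 0 show ?case
    using conv_const[of t 1 z] r_nonneg[of z] by (simp add: ennreal_le_1)
qed (auto intro!: conv_mono)

text \<open>\<open>conv\<close> sends the constant \<open>1\<close> to the probability
  \<open>1 - exp (- r z * t)\<close> of a move before \<open>t\<close>, which complements the
  waiting term.\<close>

lemma approx_plus_defect: "0 \<le> t \<Longrightarrow> approx (\<lambda>_. 1) n t z + defect n t z = 1"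
proof (induction n arbitrary: t z)
  case (Suc n)
  have "conv (approx (\<lambda>_. 1) n) t z + conv (defect n) t z = conv (\<lambda>_ _. 1) t z"
    using Suc by (subst conv_add[symmetric]) (auto intro: conv_cong)
  moreover have "ennreal (exp (- r z * t)) + ennreal (1 - exp (- r z * t)) = 1"
    using Suc.prems r_nonneg[of z] by (subst ennreal_plus[symmetric]) auto
  ultimately show ?case
    using Suc.prems by (simp add: add.assoc conv_const)
qed simp

text \<open>Exhibits \<open>approx (indicator {w}) n t z\<close> as the weights of a transition
  kernel; from their limits the coupling is later assembled as a pmf.\<close>

lemma approx_linear:
  "approx g n t z = (\<integral>\<^sup>+w. g w * approx (indicator {w}) n t z \<partial>count_space UNIV)"
proof (induction n arbitrary: t z)
  case (Suc n)
  have "conv (approx g n) t z = conv (\<lambda>u z. \<integral>\<^sup>+w. g w * approx (indicator {w}) n u z \<partial>count_space UNIV) t z"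
    using Suc.IH by (intro conv_cong) auto
  also have "\<dots> = (\<integral>\<^sup>+w. conv (\<lambda>u z. g w * approx (indicator {w}) n u z) t z \<partial>count_space UNIV)"
    unfolding conv_def
    by (subst exp_conv_nn_integral_count_space[symmetric])
       (auto simp: nn_integral_cmult nn_integral_count_space_nn_integral
          intro!: borel_measurable_times_ennreal measurable_nn_integral_pmf)
  also have "\<dots> = (\<integral>\<^sup>+w. g w * conv (approx (indicator {w}) n) t z \<partial>count_space UNIV)"
    unfolding conv_def
    by (intro nn_integral_cong, subst exp_conv_cmult[symmetric])
       (auto simp: nn_integral_cmult ac_simps
          intro!: borel_measurable_times_ennreal measurable_nn_integral_pmf)
  finally have "conv (approx g n) t z = \<dots>" .
  moreover have "g z = (\<integral>\<^sup>+w. g w * indicator {w} z \<partial>count_space UNIV)"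
    by (subst nn_integral_count_space'[of "{z}"]) (auto simp: indicator_def)
  then have "ennreal (exp (- r z * t)) * g z = (\<integral>\<^sup>+w. g w * (ennreal (exp (- r z * t))
      * indicator {w} z) \<partial>count_space UNIV)"
    by (simp add: nn_integral_cmult mult.left_commute[of "g _"])
  ultimately show ?case
    by (simp add: distrib_left nn_integral_add)
qed simp

text \<open>The expectation under \<open>p\<close> solves the backward equation, and
  \<open>approx\<close> iterates that equation from zero, hence stays below. Turning this into
  equality of marginals takes the total mass.\<close>

lemma approx_marginal_le:
  assumes proj: "proj = fst \<or> proj = snd"
    and f: "bounded (range f)" "\<And>x. 0 \<le> f x" and t: "0 \<le> t"
  shows "approx (\<lambda>w. ennreal (f (proj w))) n t z \<le> ennreal (measure_pmf.expectation (p t (proj z)) f)"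
  using t
proof (induction n arbitrary: t z)
  case (Suc n)
  have L: "L h (proj z) = r z * (measure_pmf.expectation (map_pmf proj (R z)) h - h (proj z))"
    if "bounded (range h)" for h
    using proj L_fst[OF that, of z] L_snd[OF that, of z] by (elim disjE) simp_all
  have "conv (approx (\<lambda>w. ennreal (f (proj w))) n) t z
      \<le> conv (\<lambda>u w. ennreal (measure_pmf.expectation (p u (proj w)) f)) t z"
    using Suc.IH by (intro conv_mono) auto
  also have "\<dots> = exp_conv (r z) (\<lambda>u. ennreal (r z) * (\<integral>\<^sup>+y. ennreal (measure_pmf.expectation (p u y)
      f) \<partial>map_pmf proj (R z))) t"
    by (simp add: conv_def)
  finally have "approx (\<lambda>w. ennreal (f (proj w))) (Suc n) t z
      \<le> ennreal (exp (- r z * t)) * ennreal (f (proj z)) + \<dots>"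
    unfolding approx.simps by (rule add_left_mono)
  also have "\<dots> = ennreal (measure_pmf.expectation (p t (proj z)) f)"
    by (rule semigroup_backward_equation[OF semigroup generator r_nonneg, symmetric]) (fact L f Suc.prems)+
  finally show ?case .
qed simp

text \<open>The drift condition makes \<open>exp (- \<sigma> * t) * d z\<close> a supersolution of
  the integral equation that \<open>approx\<close> iterates from zero.\<close>

lemma approx_contraction:
  assumes d: "bounded (range d)" "\<And>z. 0 \<le> d z"
    and drift: "\<And>z. r z * (measure_pmf.expectation (R z) d - d z) \<le> - \<sigma> * d z"
    and t: "0 \<le> t"
  shows "approx (\<lambda>w. ennreal (d w)) n t z \<le> ennreal (exp (- \<sigma> * t) * d z)"
  using t
proof (induction n arbitrary: t z)
  case (Suc n)
  have Ed: "0 \<le> measure_pmf.expectation (R z) d"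
    using d by (intro integral_nonneg_AE) auto
  have rd: "r z * measure_pmf.expectation (R z) d \<le> (r z - \<sigma>) * d z"
    using drift[of z] by (simp add: algebra_simps)
  have "conv (approx (\<lambda>w. ennreal (d w)) n) t z \<le> conv (\<lambda>u w. ennreal (exp (- \<sigma> * u) * d w)) t z"
    using Suc.IH by (intro conv_mono) auto
  also have "\<dots> \<le> exp_conv (r z) (\<lambda>u. ennreal (d z) * ennreal ((r z - \<sigma>) * exp (- \<sigma> * u))) t"
    unfolding conv_def
  proof (rule exp_conv_mono)
    fix u :: real
    have "(\<integral>\<^sup>+w. ennreal (exp (- \<sigma> * u) * d w) \<partial>R z) = ennreal (exp (- \<sigma> * u)
        * measure_pmf.expectation (R z) d)"
      using d by (subst nn_integral_eq_integral) (auto intro!: integrable_pmf_bounded integrable_mult_right)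
    then have "ennreal (r z) * (\<integral>\<^sup>+w. ennreal (exp (- \<sigma> * u) * d w) \<partial>R z)
        = ennreal (exp (- \<sigma> * u) * (r z * measure_pmf.expectation (R z) d))"
      using r_nonneg[of z] Ed by (simp add: ac_simps flip: ennreal_mult)
    also have "\<dots> \<le> ennreal (exp (- \<sigma> * u) * ((r z - \<sigma>) * d z))"
      using rd by (intro ennreal_leI mult_left_mono) auto
    also have "\<dots> = ennreal (d z) * ennreal ((r z - \<sigma>) * exp (- \<sigma> * u))"
      using d(2)[of z] by (simp add: ac_simps flip: ennreal_mult')
    finally show "ennreal (r z) * (\<integral>\<^sup>+w. ennreal (exp (- \<sigma> * u) * d w) \<partial>R z) \<le> \<dots>" .
  qed
  also have "\<dots> = ennreal (d z) * exp_conv (r z) (\<lambda>u. ennreal ((r z - \<sigma>) * exp (- \<sigma> * u))) t"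
    by (rule exp_conv_cmult) simp
  finally have "approx (\<lambda>w. ennreal (d w)) (Suc n) t z
      \<le> ennreal (exp (- r z * t)) * ennreal (d z) + \<dots>"
    by (simp add: add_left_mono)
  also have "\<dots> \<le> ennreal (exp (- \<sigma> * t) * d z)"
  \<comment> \<open>Where \<open>d z \<noteq> 0\<close>, the drift bound and nonnegativity of the
    expectation force \<open>\<sigma> \<le> r z\<close>, as \<open>exp_conv_exp\<close> requires;
    where \<open>d z = 0\<close>, both sides vanish.\<close>
  proof (cases "d z = 0")
    case False
    then have "0 < d z" using d(2)[of z] by simp
    moreover have "0 \<le> (r z - \<sigma>) * d z"
      using rd Ed r_nonneg[of z] by (meson mult_nonneg_nonneg order_trans)
    ultimately have "\<sigma> \<le> r z"
      by (simp add: zero_le_mult_iff)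
    moreover from this have exp_le: "exp (- r z * t) \<le> exp (- \<sigma> * t)"
      using Suc.prems by (simp add: mult_right_mono)
    ultimately have "ennreal (exp (- r z * t)) * ennreal (d z)
        + ennreal (d z) * exp_conv (r z) (\<lambda>u. ennreal ((r z - \<sigma>) * exp (- \<sigma> * u))) t
       = ennreal (d z) * (ennreal (exp (- r z * t)) + ennreal (exp (- \<sigma> * t) - exp (- r z * t)))"
      using Suc.prems by (simp only: exp_conv_exp[OF \<open>\<sigma> \<le> r z\<close>]) (simp add: distrib_left mult.commute)
    also have "\<dots> = ennreal (d z) * ennreal (exp (- \<sigma> * t))"
      using exp_le by (subst ennreal_plus[symmetric]) auto
    finally show ?thesis
      using d(2)[of z] by (simp add: mult.commute flip: ennreal_mult)
  qed simp
  finally show ?case .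
qed (simp add: d)

section \<open>Mass lost to infinitely many moves\<close>

lemma INF_defect_le_conv:
  assumes "0 \<le> t"
  shows "(INF n. defect n t z) \<le> conv (\<lambda>u w. INF n. defect n u w) t z"
proof -
  have le1: "defect n u w \<le> 1" if "0 \<le> u" for n u w
    using approx_plus_defect[OF that, of n w] by (metis le_add2 add.commute le_iff_add)
  have meas: "(\<lambda>u. \<integral>\<^sup>+w. defect n u w \<partial>R z) \<in> borel_measurable borel" for n
    by (intro measurable_nn_integral_pmf) simp
  \<comment> \<open>Monotone convergence from above, once for the integral over \<open>R z\<close>
    and once for the time integral; finiteness comes from the bound \<open>1\<close> on the
    defects.\<close>
  have "conv (\<lambda>u w. INF n. defect n u w) t z = (INF n. conv (defect n) t z)"
  proof -
    have *: "ennreal (exp (- r z * (t - u))) * (ennreal (r z) *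
        (\<integral>\<^sup>+w. (INF n. defect n u w) \<partial>R z)) * indicator {0..t} u
      = (INF n. ennreal (exp (- r z * (t - u))) * (ennreal (r z) *
          (\<integral>\<^sup>+w. defect n u w \<partial>R z)) * indicator {0..t} u)" for u
    proof (cases "u \<in> {0..t}")
      case True
      have "(\<integral>\<^sup>+w. (INF n. defect n u w) \<partial>R z) = (INF n. \<integral>\<^sup>+w. defect n u w \<partial>R z)"
      proof (rule nn_integral_monotone_convergence_INF_decseq)
        show "decseq (\<lambda>n w. defect n u w)"
          using True by (auto intro!: decseq_SucI le_funI defect_antimono)
        have "(\<integral>\<^sup>+w. defect n u w \<partial>R z) \<le> (\<integral>\<^sup>+w. 1 \<partial>R z)" for n
          using True by (intro nn_integral_mono le1) auto
        also have "\<dots> < \<infinity>"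
          by (simp add: measure_pmf.emeasure_space_1)
        finally show "(\<integral>\<^sup>+w. defect n u w \<partial>R z) < \<infinity>" for n .
      qed simp
      moreover have "decseq (\<lambda>n. \<integral>\<^sup>+w. defect n u w \<partial>R z)"
        using True by (auto intro!: decseq_SucI nn_integral_mono defect_antimono simp del: defect.simps)
      ultimately show ?thesis
        using True ennreal_mult_INF_decseq[of "ennreal (exp (- r z * (t
            - u))) * ennreal (r z)" "\<lambda>n. \<integral>\<^sup>+w. defect n u w \<partial>R z"]
        by (simp add: ennreal_mult_less_top mult.assoc)
    qed simp
    show ?thesis
      unfolding conv_def exp_conv_def *
    proof (rule nn_integral_monotone_convergence_INF_decseq)
      show "decseq (\<lambda>n u. ennreal (exp (- r z * (t - u))) * (ennreal (r z) *
          (\<integral>\<^sup>+w. defect n u w \<partial>R z)) * indicator {0..t} u)"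
        by (auto intro!: decseq_SucI le_funI mult_left_mono nn_integral_mono defect_antimono split:
            split_indicator simp del: defect.simps)
      show "(\<lambda>u. ennreal (exp (- r z * (t - u))) * (ennreal (r z) *
          (\<integral>\<^sup>+w. defect n u w \<partial>R z)) * indicator {0..t} u) \<in> borel_measurable lborel" for n
        using meas[of n] by simp
      have "(\<integral>\<^sup>+u. ennreal (exp (- r z * (t - u))) * (ennreal (r z) *
          (\<integral>\<^sup>+w. defect n u w \<partial>R z)) * indicator {0..t} u \<partial>lborel)
          = defect (Suc n) t z" for n
        by (simp add: conv_def exp_conv_def)
      then show "(\<integral>\<^sup>+u. ennreal (exp (- r z * (t - u))) * (ennreal (r z) *
          (\<integral>\<^sup>+w. defect n u w \<partial>R z)) * indicator {0..t} u \<partial>lborel) < \<infinity>" for n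
        using le1[OF assms, of "Suc n" z] by (simp del: defect.simps) (metis ennreal_one_less_top
            order_le_less_trans)
    qed
  qed
  also have "\<dots> = (INF n. defect (Suc n) t z)" by simp
  also have "(INF n. defect n t z) \<le> \<dots>"
    by (intro INF_greatest INF_lower) simp
  finally show ?thesis .
qed

text \<open>Moves that leave \<open>z\<close> unchanged make the integral equation refer to \<open>z\<close> itself; this contribution
  is removed by iteration, since such a move occurs before \<open>t\<close> with probability at most
  \<open>1 - exp (- r z * t) < 1\<close>.\<close>

lemma INF_defect_le_jump_time_cdf:
  "0 \<le> t \<Longrightarrow> (INF n. defect n t z) \<le> jump_time_cdf L k t (fst z) + jump_time_cdf L l t (snd z)"
\<comment> \<open>A move that changes only one component lowers only one of \<open>k\<close> and
  \<open>l\<close>, so the induction runs on their sum.\<close>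
proof (induction "k + l" arbitrary: k l t z rule: less_induct)
  case less
  have le1: "(INF n. defect n u w) \<le> 1" for u w
    by (rule INF_lower2[of 0]) auto
  show ?case
  proof (cases "k = 0 \<or> l = 0")
    case True
    then show ?thesis
      using le1[of t z] by (auto intro: order_trans)
  next
    case False
    then obtain k' l' where kl: "k = Suc k'" "l = Suc l'"
      by (meson not0_implies_Suc)
    \<comment> \<open>\<open>h1\<close> and \<open>h2\<close> are the bounds after one move: a
      component that stayed put still has all its jumps to make, one that moved has one
      fewer.\<close>
    define h1 where "h1 u y = (if y = fst z then jump_time_cdf L k u (fst z) else jump_time_cdf L k'
        u y)" for u y
    define h2 where "h2 u y = (if y = snd z then jump_time_cdf L l u (snd z) else jump_time_cdf L l'
        u y)" for u y
    define H where "H u = jump_time_cdf L k u (fst z) + jump_time_cdf L l u (snd z)" for u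
    have [measurable]: "(\<lambda>u. h1 u y) \<in> borel_measurable borel" "(\<lambda>u. h2 u y) \<in> borel_measurable borel" for y
      unfolding h1_def h2_def by (cases "y = fst z"; simp)+
    have H: "conv (\<lambda>u w. h1 u (fst w) + h2 u (snd w)) u z = H u" if "0 \<le> u" for u
    proof -
      have "conv (\<lambda>u w. h1 u (fst w)) u z = jump_time_cdf L k u (fst z)"
        using jump_time_cdf_Suc_pmf[of "r z" L "fst z" "map_pmf fst (R z)" u k', OF r_nonneg L_fst that]
        unfolding conv_def h1_def kl by (simp del: jump_time_cdf.simps)
      moreover have "conv (\<lambda>u w. h2 u (snd w)) u z = jump_time_cdf L l u (snd z)"
        using jump_time_cdf_Suc_pmf[of "r z" L "snd z" "map_pmf snd (R z)" u l', OF r_nonneg L_snd that]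
        unfolding conv_def h2_def kl by (simp del: jump_time_cdf.simps)
      ultimately show ?thesis
        by (simp add: conv_add H_def)
    qed
    define q where "q = 1 - exp (- r z * t)"
    have q: "0 \<le> q" "q < 1"
      using r_nonneg[of z] less.prems by (auto simp: q_def)
    have bound: "(INF n. defect n u z) \<le> H u + ennreal (q ^ n)" if "0 \<le> u" "u \<le> t" for n u
      using that
    proof (induction n arbitrary: u)
      case 0
      then show ?case using le1[of u z] by (auto intro: order_trans)
    next
      case (Suc n)
      have "(INF n. defect n v w) \<le> h1 v (fst w) + h2 v (snd w) + ennreal (q ^ n)" if "0 \<le> v" "v
          \<le> u" for v w
      \<comment> \<open>At \<open>w = z\<close> neither count drops and the outer induction gives
        nothing, so the bound from the previous round of the inner induction is used.\<close>
      proof (cases "w = z")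
        case True
        with Suc.IH[of v] Suc.prems that show ?thesis
          by (simp add: h1_def h2_def H_def)
      next
        case False
        then consider "fst w \<noteq> fst z" "snd w \<noteq> snd z" | "fst w \<noteq> fst z" "snd w = snd z" | "fst w
            = fst z" "snd w \<noteq> snd z"
          by (metis prod.expand)
        then have "(INF n. defect n v w) \<le> h1 v (fst w) + h2 v (snd w)"
        proof cases
          case 1
          then show ?thesis
            using less.hyps[of k' l' v w] that kl by (simp add: h1_def h2_def)
        next
          case 2
          then show ?thesis
            using less.hyps[of k' l v w] that kl by (simp add: h1_def h2_def del: jump_time_cdf.simps)
        next
          case 3
          then show ?thesis
            using less.hyps[of k l' v w] that kl by (simp add: h1_def h2_def del: jump_time_cdf.simps)
        qed
        then show ?thesis by (rule order_trans) simp
      qed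
      then have "conv (\<lambda>v w. INF n. defect n v w) u z \<le> conv (\<lambda>v w. h1 v (fst w) + h2 v (snd w)
          + ennreal (q ^ n)) u z"
        by (rule conv_mono)
      also have "\<dots> = H u + ennreal (1 - exp (- r z * u)) * ennreal (q ^ n)"
        using Suc.prems by (subst conv_add) (auto simp: H conv_const)
      also have "\<dots> \<le> H u + ennreal q * ennreal (q ^ n)"
        using Suc.prems r_nonneg[of z] by (intro add_left_mono mult_right_mono ennreal_leI) (auto
            simp: q_def mult_left_mono)
      also have "\<dots> = H u + ennreal (q ^ Suc n)"
        using q by (simp flip: ennreal_mult)
      finally show ?case
        using INF_defect_le_conv[OF Suc.prems(1), of z] by (rule order_trans[rotated])
    qed
    have "(\<lambda>n. H t + ennreal (q ^ n)) \<longlonglongrightarrow> H t + ennreal 0"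
      using q by (intro tendsto_intros LIMSEQ_power_zero) auto
    then have "(INF n. defect n t z) \<le> H t + ennreal 0"
      using bound[of t] less.prems by (intro LIMSEQ_le_const) auto
    then show ?thesis by (simp add: H_def)
  qed
qed

text \<open>With both jump counts sent to infinity in \<open>INF_defect_le_jump_time_cdf\<close>,
  non-explosion forces the limiting defect to be \<open>0\<close>.\<close>

lemma SUP_approx_mass:
  assumes t: "0 \<le> t"
  shows "(SUP n. approx (\<lambda>_. 1) n t z) = 1"
proof -
  have "(\<lambda>n. jump_time_cdf L n t (fst z) + jump_time_cdf L n t (snd z)) \<longlonglongrightarrow> 0 + 0"
    using nonexplosive t unfolding nonexplosive_def by (intro tendsto_add) auto
  then have "(INF n. defect n t z) \<le> 0 + 0"
    using INF_defect_le_jump_time_cdf[OF t, of z] by (intro LIMSEQ_le_const) auto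
  moreover have "(\<lambda>n. defect n t z) \<longlonglongrightarrow> (INF n. defect n t z)"
    by (intro LIMSEQ_INF decseq_SucI defect_antimono t)
  ultimately have "(\<lambda>n. defect n t z) \<longlonglongrightarrow> 0" by simp
  then have "(\<lambda>n. approx (\<lambda>_. 1) n t z + defect n t z) \<longlonglongrightarrow> (SUP n. approx (\<lambda>_. 1) n t z) + 0"
    by (intro tendsto_add LIMSEQ_SUP approx_incseq)
  then show ?thesis
    using approx_plus_defect[OF t] by (simp add: LIMSEQ_const_iff)
qed

text \<open>The limit of \<open>approx\<close> is the required coupling: its weights have total mass
  one, its marginals are dominated by the laws under \<open>p\<close> and therefore equal to them,
  and the contraction bound passes to the supremum.\<close>

theorem wasserstein_contraction:
  assumes d: "bounded (range d)" "\<And>z. 0 \<le> d z"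
    and drift: "\<And>z. r z * (measure_pmf.expectation (R z) d - d z) \<le> - \<sigma> * d z"
    and t: "0 \<le> t"
  shows "wasserstein (\<lambda>x y. d (x, y)) (p t x) (p t y) \<le> ennreal (exp (- \<sigma> * t) * d (x, y))"
proof -
  define Q where "Q w = (SUP n. approx (indicator {w}) n t (x, y))" for w
  have Q_int: "(\<integral>\<^sup>+w. Q w * g w \<partial>count_space UNIV) = (SUP n. approx g n t (x, y))" for g
  proof -
    have "(\<integral>\<^sup>+w. Q w * g w \<partial>count_space UNIV)
        = (\<integral>\<^sup>+w. (SUP n. g w * approx (indicator {w}) n t (x, y)) \<partial>count_space UNIV)"
      by (simp add: Q_def SUP_mult_left_ennreal mult.commute)
    also have "\<dots> = (SUP n. \<integral>\<^sup>+w. g w * approx (indicator {w}) n t (x, y) \<partial>count_space UNIV)"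
      by (intro nn_integral_monotone_convergence_SUP)
         (auto intro!: incseq_SucI le_funI mult_left_mono approx_mono simp del: approx.simps)
    finally show ?thesis by (simp flip: approx_linear)
  qed
  have Q_mass: "(\<integral>\<^sup>+w. Q w \<partial>count_space UNIV) = 1"
    using Q_int[of "\<lambda>_. 1"] SUP_approx_mass[OF t] by simp
  have "Q w \<le> (\<integral>\<^sup>+w. Q w \<partial>count_space UNIV)" for w
    by (rule nn_integral_ge_point) simp
  then have Q_fin: "ennreal (enn2real (Q w)) = Q w" for w
    using Q_mass by (metis ennreal_enn2real ennreal_one_less_top order_le_less_trans)
  define \<pi> where "\<pi> = embed_pmf (\<lambda>w. enn2real (Q w))"
  have \<pi>: "pmf \<pi> w = enn2real (Q w)" for w
    unfolding \<pi>_def by (rule pmf_embed_pmf) (auto simp: Q_fin Q_mass)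
  have \<pi>_int: "(\<integral>\<^sup>+w. g w \<partial>\<pi>) = (SUP n. approx g n t (x, y))" for g
    by (simp add: nn_integral_measure_pmf \<pi> Q_fin Q_int)
  \<comment> \<open>Two distinct pmfs each exceed the other somewhere, so one-sided domination
    between them is already equality.\<close>
  have marginal: "map_pmf proj \<pi> = p t (proj (x, y))" if "proj = fst \<or> proj = snd" for proj
  proof (rule ccontr)
    assume "map_pmf proj \<pi> \<noteq> p t (proj (x, y))"
    then obtain a where a: "pmf (p t (proj (x, y))) a < pmf (map_pmf proj \<pi>) a"
      by (metis pmf_neq_exists_less)
    have "ennreal (pmf (map_pmf proj \<pi>) a) = (\<integral>\<^sup>+w. ennreal (indicator {a} (proj w)) \<partial>\<pi>)"
      unfolding ennreal_pmf_map by (intro nn_integral_cong) (auto simp: indicator_def)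
    also have "\<dots> \<le> ennreal (measure_pmf.expectation (p t (proj (x, y))) (indicator {a}))"
      unfolding \<pi>_int
      by (intro SUP_least approx_marginal_le that t) (auto simp: bounded_iff indicator_def
          intro!: exI[of _ 1])
    also have "\<dots> = ennreal (pmf (p t (proj (x, y))) a)"
      by (simp add: pmf.rep_eq)
    finally show False using a by simp
  qed
  have "\<pi> \<in> couplings (p t x) (p t y)"
    using marginal[of fst] marginal[of snd] by (simp add: couplings_def)
  then have "wasserstein (\<lambda>x y. d (x, y)) (p t x) (p t y) \<le> (\<integral>\<^sup>+w. ennreal (d w) \<partial>\<pi>)"
    unfolding wasserstein_def by (rule INF_lower2) simp
  also have "\<dots> \<le> ennreal (exp (- \<sigma> * t) * d (x, y))"
    unfolding \<pi>_int by (intro SUP_least approx_contraction d drift t)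
  finally show ?thesis .
qed

end

section \<open>The zero range process\<close>

lemma trivial_dist_simps [simp]:
  "trivial_dist x x = 0" "x \<noteq> y \<Longrightarrow> trivial_dist x y = 1"
  by (simp_all add: trivial_dist_def)

lemma trivial_dist_bounds: "0 \<le> trivial_dist x y" "trivial_dist x y \<le> 1"
  by (simp_all add: trivial_dist_def)

section \<open>Generators as mixtures of laws, and couplings of single particles\<close>

lemma infsum_pmf_mult:
  fixes g :: "'b \<Rightarrow> real"
  assumes "bounded (range g)"
  shows "(\<Sum>\<^sub>\<infinity>y. pmf M y * g y) = measure_pmf.expectation M g"
proof -
  have "integrable (measure_pmf M) g"
    using assms by (rule integrable_pmf_bounded)
  then have "Infinite_Set_Sum.abs_summable_on (\<lambda>y. pmf M y * g y) UNIV"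
    unfolding measure_pmf_eq_density Infinite_Set_Sum.abs_summable_on_def
    by (subst (asm) integrable_density) auto
  then have "infsetsum (\<lambda>y. pmf M y * g y) UNIV = (\<Sum>\<^sub>\<infinity>y. pmf M y * g y)"
    by (rule infsetsum_infsum)
  then show ?thesis by (simp add: pmf_expectation_eq_infsetsum)
qed

lemma zr_generator_expectation:
  fixes f :: "('n::finite \<Rightarrow> 'a) \<Rightarrow> real"
  assumes f: "bounded (range f)"
  shows "zr_generator c P f x = (\<Sum>i\<in>UNIV. c (x i) (occupation x (x i)) *
    (measure_pmf.expectation (P (x i)) (\<lambda>u. f (x(i := u))) - f x))"
proof -
  have fi: "bounded (range (\<lambda>u. f (x(i := u))))" for i
    using f by (auto simp: bounded_iff)
  moreover have "bounded (range (\<lambda>u. f (x(i := u)) - f x))" for i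
    using fi by (rule bounded_minus_comp) simp
  ultimately show ?thesis
    unfolding zr_generator_def by (simp add: infsum_pmf_mult integrable_pmf_bounded)
qed

text \<open>Superposition of finitely many jump mechanisms: \<open>r\<close> is the total rate and
  \<open>R\<close> mixes the laws \<open>\<kappa> j\<close> with weights
  \<open>\<rho> j / r\<close>. A vanishing total rate is treated apart, with an arbitrary
  law.\<close>

lemma ex_pmf_of_rates:
  fixes \<rho> :: "'j \<Rightarrow> real" and \<kappa> :: "'j \<Rightarrow> 's pmf"
  assumes J: "finite J" and \<rho>: "\<And>j. j \<in> J \<Longrightarrow> 0 \<le> \<rho> j"
  shows "\<exists>r R. 0 \<le> r \<and> (\<forall>f. bounded (range f) \<longrightarrow>
    r * (measure_pmf.expectation R f - f z) = (\<Sum>j\<in>J. \<rho> j * (measure_pmf.expectation (\<kappa> j) f - f z)))"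
proof -
  define r where "r = (\<Sum>j\<in>J. \<rho> j)"
  have r: "0 \<le> r"
    unfolding r_def using \<rho> by (rule sum_nonneg)
  show ?thesis
  proof (cases "r = 0")
    case True
    then have "\<rho> j = 0" if "j \<in> J" for j
      using that \<rho> J sum_nonneg_eq_0_iff[of J \<rho>] by (auto simp: r_def)
    then show ?thesis
      by (intro exI[of _ 0]) simp
  next
    case False
    define \<mu> where "\<mu> = embed_pmf (\<lambda>j. if j \<in> J then \<rho> j / r else 0)"
    have \<mu>: "pmf \<mu> j = (if j \<in> J then \<rho> j / r else 0)" for j
      unfolding \<mu>_def
    proof (rule pmf_embed_pmf)
      have "(\<integral>\<^sup>+j. ennreal (if j \<in> J then \<rho> j / r else 0) \<partial>count_space UNIV) = (\<Sum>j\<in>J. ennreal (\<rho> j / r))"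
        using J by (subst nn_integral_count_space'[of J]) auto
      also have "\<dots> = ennreal (\<Sum>j\<in>J. \<rho> j / r)"
        using \<rho> r by (subst sum_ennreal) auto
      also have "(\<Sum>j\<in>J. \<rho> j / r) = 1"
        using False by (simp add: r_def flip: sum_divide_distrib)
      finally show "(\<integral>\<^sup>+j. ennreal (if j \<in> J then \<rho> j / r else 0) \<partial>count_space UNIV) = 1"
        by simp
    qed (use \<rho> r in auto)
    have "r * (measure_pmf.expectation (bind_pmf \<mu> \<kappa>) f - f z)
        = (\<Sum>j\<in>J. \<rho> j * (measure_pmf.expectation (\<kappa> j) f - f z))"
      if "bounded (range f)" for f
    proof -
      have "measure_pmf.expectation (bind_pmf \<mu> \<kappa>) f = (\<Sum>j\<in>J. measure_pmf.expectation (\<kappa> j) f * pmf \<mu> j)"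
        unfolding expectation_bind_pmf_bounded[OF that]
        by (rule integral_measure_pmf_real) (use J in \<open>auto simp: set_pmf_eq \<mu> split: if_splits\<close>)
      also have "\<dots> = (\<Sum>j\<in>J. \<rho> j * measure_pmf.expectation (\<kappa> j) f) / r"
        by (simp add: \<mu> sum_divide_distrib mult.commute)
      finally have "r * (measure_pmf.expectation (bind_pmf \<mu> \<kappa>) f - f z)
          = (\<Sum>j\<in>J. \<rho> j * measure_pmf.expectation (\<kappa> j) f) - r * f z"
        using False by (simp add: right_diff_distrib)
      then show ?thesis
        by (simp add: right_diff_distrib sum_subtractf r_def sum_distrib_right)
    qed
    with r show ?thesis by blast
  qed
qed

text \<open>The slack \<open>e\<close> avoids the question whether the infimum is attained. The
  product coupling, of cost at most \<open>D\<close>, shows that the infimum is finite, so that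
  \<open>enn2real\<close> loses nothing.\<close>

lemma ex_near_optimal_coupling:
  fixes d :: "'s \<Rightarrow> 's \<Rightarrow> real"
  assumes d: "\<And>x y. 0 \<le> d x y" "\<And>x y. d x y \<le> D" and e: "0 < e"
  shows "\<exists>\<pi>\<in>couplings \<mu> \<nu>. measure_pmf.expectation \<pi> (\<lambda>w. d (fst w) (snd w))
      \<le> enn2real (wasserstein d \<mu> \<nu>) + e"
proof -
  have nn: "(\<integral>\<^sup>+w. ennreal (d (fst w) (snd w)) \<partial>measure_pmf \<pi>)
      = ennreal (measure_pmf.expectation \<pi> (\<lambda>w. d (fst w) (snd w)))" for \<pi>
    using d by (intro nn_integral_eq_integral integrable_pmf_bounded) (auto simp: bounded_iff
        intro!: exI[of _ D])
  have pair: "pair_pmf \<mu> \<nu> \<in> couplings \<mu> \<nu>"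
    by (simp add: couplings_def map_fst_pair_pmf map_snd_pair_pmf)
  have "wasserstein d \<mu> \<nu> \<le> ennreal (measure_pmf.expectation (pair_pmf \<mu> \<nu>) (\<lambda>w. d (fst w) (snd w)))"
    unfolding wasserstein_def using pair by (rule INF_lower2) (simp add: nn)
  then have W: "wasserstein d \<mu> \<nu> = ennreal (enn2real (wasserstein d \<mu> \<nu>))"
    by (metis ennreal_enn2real ennreal_less_top order_le_less_trans)
  also have "\<dots> < ennreal (enn2real (wasserstein d \<mu> \<nu>) + e)"
    using e by (intro ennreal_lessI) (auto simp: add_nonneg_pos)
  finally have "wasserstein d \<mu> \<nu> < ennreal (enn2real (wasserstein d \<mu> \<nu>) + e)" .
  then obtain \<pi> where "\<pi> \<in> couplings \<mu> \<nu>"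
      "ennreal (measure_pmf.expectation \<pi> (\<lambda>w. d (fst w) (snd w))) < ennreal (enn2real (wasserstein
          d \<mu> \<nu>) + e)"
    by (subst (asm) (1) wasserstein_def) (auto simp: INF_less_iff nn)
  then have "measure_pmf.expectation \<pi> (\<lambda>w. d (fst w) (snd w)) \<le> enn2real (wasserstein d \<mu> \<nu>) + e"
    by (meson ennreal_leI leD le_cases)
  with \<open>\<pi> \<in> couplings \<mu> \<nu>\<close> show ?thesis ..
qed

text \<open>Equal particles move together along the diagonal at no cost. Distinct ones follow a
  nearly optimal coupling, whose expected decrease of the distance is
  \<open>coarse_ricci_along\<close> up to the slack.\<close>

lemma ex_particle_coupling:
  assumes \<epsilon>: "0 < \<epsilon>" and s: "0 \<le> s" and A: "x \<noteq> y \<Longrightarrow> A \<le> coarse_ricci_along trivial_dist P x y * s"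
  shows "\<exists>\<pi>\<in>couplings (P x) (P y).
    s * (measure_pmf.expectation \<pi> (\<lambda>w. trivial_dist (fst w) (snd w)) - trivial_dist x y) \<le> (\<epsilon>
        - A) * trivial_dist x y"
proof (cases "x = y")
  case True
  have "map_pmf (\<lambda>u. (u, u)) (P x) \<in> couplings (P x) (P y)"
    using True by (simp add: couplings_def pmf.map_comp o_def)
  then show ?thesis
    using True by (intro bexI) auto
next
  case False
  \<comment> \<open>Division by \<open>s + 1\<close>, positive even for \<open>s = 0\<close>, keeps
    the error \<open>s * e\<close> at most \<open>\<epsilon>\<close>.\<close>
  define e where "e = \<epsilon> / (s + 1)"
  have e: "0 < e" "s * e \<le> \<epsilon>"
    using \<epsilon> s by (auto simp: e_def field_simps)
  obtain \<pi> where \<pi>: "\<pi> \<in> couplings (P x) (P y)"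
    "measure_pmf.expectation \<pi> (\<lambda>w. trivial_dist (fst w) (snd w))
        \<le> enn2real (wasserstein trivial_dist (P x) (P y)) + e"
    using ex_near_optimal_coupling[of trivial_dist 1 e "P x" "P y"] e(1) trivial_dist_bounds by blast
  have "s * (measure_pmf.expectation \<pi> (\<lambda>w. trivial_dist (fst w) (snd w)) - 1)
      \<le> s * (enn2real (wasserstein trivial_dist (P x) (P y)) + e - 1)"
    using \<pi>(2) s by (intro mult_left_mono) auto
  also have "\<dots> \<le> \<epsilon> - A"
    using A[OF False] e(2) False by (simp add: coarse_ricci_along_def algebra_simps)
  finally show ?thesis
    using False \<pi>(1) by (intro bexI[of _ \<pi>]) auto
qed

section \<open>Mean distance and occupation numbers\<close>

lemma mean_dist_update:
  fixes x y :: "'n::finite \<Rightarrow> 'a"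
  shows "mean_dist d (x(i := u)) (y(i := v)) = mean_dist d x y + (d u v - d (x i) (y i)) / CARD('n)"
proof -
  have "(\<Sum>j\<in>UNIV. d ((x(i := u)) j) ((y(i := v)) j)) = d u v + (\<Sum>j\<in>UNIV - {i}. d (x j) (y j))"
    by (subst sum.remove[of _ i]) auto
  also have "\<dots> = (\<Sum>j\<in>UNIV. d (x j) (y j)) + (d u v - d (x i) (y i))"
    by (subst (2) sum.remove[of _ i]) auto
  finally show ?thesis
    by (simp add: mean_dist_def add_divide_distrib)
qed

lemma mean_dist_trivial_bounds:
  fixes x y :: "'n::finite \<Rightarrow> 'a"
  shows "0 \<le> mean_dist trivial_dist x y" "mean_dist trivial_dist x y \<le> 1"
proof -
  have "(\<Sum>i\<in>UNIV. trivial_dist (x i) (y i)) \<le> (\<Sum>i\<in>(UNIV :: 'n set). 1)"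
    by (intro sum_mono trivial_dist_bounds)
  then show "mean_dist trivial_dist x y \<le> 1"
    by (simp add: mean_dist_def field_simps)
  show "0 \<le> mean_dist trivial_dist x y"
    unfolding mean_dist_def by (intro mult_nonneg_nonneg sum_nonneg trivial_dist_bounds) auto
qed

lemma occupation_pos: "1 \<le> occupation x (x i)"
  unfolding occupation_def by (auto simp: Suc_le_eq card_gt_0_iff)

text \<open>Each unmatched pair affects the difference of occupation numbers at no more than two
  sites, by one each; this is the source of the factor \<open>2\<close>.\<close>

lemma sum_occupation_diff_le:
  fixes x y :: "'n::finite \<Rightarrow> 'a"
  assumes V: "finite V"
  shows "(\<Sum>v\<in>V. \<bar>real (occupation x v) - real (occupation y v)\<bar>) \<le> 2 * (\<Sum>i\<in>UNIV. trivial_dist (x i) (y i))"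
proof -
  have occ: "real (occupation z v) = (\<Sum>i\<in>UNIV. of_bool (z i = v))" for z :: "'n \<Rightarrow> 'a" and v
    by (simp add: occupation_def)
  have "(\<Sum>v\<in>V. \<bar>real (occupation x v) - real (occupation y v)\<bar>)
      \<le> (\<Sum>v\<in>V. \<Sum>i\<in>UNIV. \<bar>of_bool (x i = v) - of_bool (y i = v)\<bar>)"
    unfolding occ by (intro sum_mono) (simp only: sum_subtractf[symmetric] sum_abs)
  also have "\<dots> = (\<Sum>i\<in>UNIV. \<Sum>v\<in>V. \<bar>of_bool (x i = v) - of_bool (y i = v)\<bar>)"
    by (rule sum.swap)
  also have "\<dots> \<le> (\<Sum>i\<in>UNIV. 2 * trivial_dist (x i) (y i))"
  proof (rule sum_mono)
    fix i
    have "(\<Sum>v\<in>V. \<bar>of_bool (x i = v) - of_bool (y i = v)\<bar> :: real) \<le> (\<Sum>v\<in>V. of_bool (x i = v)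
        + of_bool (y i = v))"
      by (intro sum_mono) auto
    also have "\<dots> \<le> 2"
      using V by (simp add: sum.distrib of_bool_def sum.delta')
    finally show "(\<Sum>v\<in>V. \<bar>of_bool (x i = v) - of_bool (y i = v)\<bar>) \<le> 2 * trivial_dist (x i) (y i)"
      by (cases "x i = y i") auto
  qed
  finally show ?thesis by (simp add: sum_distrib_left)
qed

text \<open>Matched pairs are grouped by their common site. Their number there is at most the
  smaller occupation number \<open>n\<close>; if the larger one is \<open>n + m\<close>, the factor
  \<open>n / m\<close> in the hypothesis bounds \<open>n\<close> times the weighted rate difference
  by \<open>B * m\<close>. The differences \<open>m\<close> are then summed by
  \<open>sum_occupation_diff_le\<close>.\<close>

lemma matched_rate_difference_le:
  fixes x y :: "'n::finite \<Rightarrow> 'a" and c :: "'a \<Rightarrow> nat \<Rightarrow> real"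
  assumes B: "\<And>v n m. 1 \<le> n \<Longrightarrow> 1 \<le> m \<Longrightarrow> w v * (real n / real m) * \<bar>c v n - c v (n + m)\<bar> \<le> B"
    and w: "\<And>v. 0 \<le> w v"
  shows "(\<Sum>i | x i = y i. w (x i) * \<bar>c (x i) (occupation x (x i)) - c (y i) (occupation y (y i))\<bar>)
    \<le> 2 * B * (\<Sum>i\<in>UNIV. trivial_dist (x i) (y i))"
proof -
  define S where "S = {i. x i = y i}"
  define F where "F v = w v * \<bar>c v (occupation x v) - c v (occupation y v)\<bar>" for v
  have B_nonneg: "0 \<le> B"
    using B[of 1 1 undefined] w[of undefined] by (meson abs_ge_zero divide_nonneg_nonneg
        mult_nonneg_nonneg of_nat_0_le_iff order_trans order_refl)
  have *: "real k * (w v * \<bar>c v n - c v n'\<bar>) \<le> B * \<bar>real n - real n'\<bar>"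
    if "1 \<le> n" "n < n'" "k \<le> n" for k n n' v
  proof -
    have "real k * (w v * \<bar>c v n - c v n'\<bar>) \<le> real n * (w v * \<bar>c v n - c v n'\<bar>)"
      using that w[of v] by (intro mult_right_mono) auto
    also have "\<dots> \<le> B * real (n' - n)"
      using B[of n "n' - n" v] that by (simp add: field_simps)
    finally show ?thesis
      using that by (simp add: of_nat_diff)
  qed
  have "(\<Sum>i\<in>S. F (x i)) = (\<Sum>v\<in>x ` S. \<Sum>i\<in>{i\<in>S. x i = v}. F (x i))"
    by (rule sum.image_gen) simp
  also have "\<dots> \<le> (\<Sum>v\<in>x ` S. B * \<bar>real (occupation x v) - real (occupation y v)\<bar>)"
  proof (rule sum_mono)
    fix v assume "v \<in> x ` S"
    then obtain i where i: "x i = v" "y i = v" by (auto simp: S_def)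
    have le: "card {i\<in>S. x i = v} \<le> occupation x v" "card {i\<in>S. x i = v} \<le> occupation y v"
      unfolding occupation_def S_def by (auto intro!: card_mono)
    have ge: "1 \<le> occupation x v" "1 \<le> occupation y v"
      using occupation_pos[of x i] occupation_pos[of y i] i by auto
    have "(\<Sum>i\<in>{i\<in>S. x i = v}. F (x i)) = real (card {i\<in>S. x i = v}) * F v"
      by simp
    also have "\<dots> \<le> B * \<bar>real (occupation x v) - real (occupation y v)\<bar>"
      using *[of "occupation x v" "occupation y v" "card {i\<in>S. x i
          = v}" v] *[of "occupation y v" "occupation x v" "card {i\<in>S. x i = v}" v] le ge
      unfolding F_def
      by (cases "occupation x v" "occupation y v" rule: linorder_cases) (auto simp: abs_minus_commute)
    finally show "(\<Sum>i\<in>{i\<in>S. x i = v}. F (x i)) \<le> B * \<bar>real (occupation x v) - real (occupation y v)\<bar>" .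
  qed
  also have "\<dots> = B * (\<Sum>v\<in>x ` S. \<bar>real (occupation x v) - real (occupation y v)\<bar>)"
    by (simp add: sum_distrib_left)
  also have "\<dots> \<le> B * (2 * (\<Sum>i\<in>UNIV. trivial_dist (x i) (y i)))"
    using B_nonneg by (intro mult_left_mono sum_occupation_diff_le) auto
  finally show ?thesis
    by (simp add: S_def F_def mult.assoc mult.left_commute)
qed

text \<open>One coupled move at a fixed \<open>z\<close>, in the form required by
  \<open>jump_coupling\<close>. The \<open>\<epsilon>\<close> is the price for particle couplings
  that are only nearly optimal.\<close>

lemma ex_zero_range_coupling:
  fixes P :: "'a \<Rightarrow> 'a pmf" and z :: "('n::finite \<Rightarrow> 'a) \<times> ('n \<Rightarrow> 'a)"
  assumes c: "\<And>x n. 1 \<le> n \<Longrightarrow> 0 \<le> c x n" and \<epsilon>: "0 < \<epsilon>"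
    and A: "\<And>x y n m. 1 \<le> n \<Longrightarrow> 1 \<le> m \<Longrightarrow> A \<le> coarse_ricci_along trivial_dist P x y * min (c x n) (c y m)"
    and B: "\<And>x n m. 1 \<le> n \<Longrightarrow> 1 \<le> m \<Longrightarrow> (1 - pmf (P x) x) * (real n / real m) * \<bar>c x n - c x (n + m)\<bar> \<le> B"
  shows "\<exists>r R. 0 \<le> r \<and>
    (\<forall>f. bounded (range f) \<longrightarrow> zr_generator c P f (fst z) = r * (measure_pmf.expectation (map_pmf fst
        R) f - f (fst z))) \<and>
    (\<forall>f. bounded (range f) \<longrightarrow> zr_generator c P f (snd z) = r * (measure_pmf.expectation (map_pmf snd
        R) f - f (snd z))) \<and>
    r * (measure_pmf.expectation R (\<lambda>w. mean_dist trivial_dist (fst w) (snd w))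
        - mean_dist trivial_dist (fst z) (snd z))
      \<le> - (A - 2 * B - \<epsilon>) * mean_dist trivial_dist (fst z) (snd z)"
proof -
  obtain x y where z: "z = (x, y)" by (cases z)
  define a where "a i = c (x i) (occupation x (x i))" for i
  define b where "b i = c (y i) (occupation y (y i))" for i
  have ab: "0 \<le> a i" "0 \<le> b i" for i
    unfolding a_def b_def by (auto intro: c occupation_pos)
  have "\<exists>\<pi>\<in>couplings (P (x i)) (P (y i)).
    min (a i) (b i) * (measure_pmf.expectation \<pi> (\<lambda>w. trivial_dist (fst w) (snd w))
        - trivial_dist (x i) (y i))
      \<le> (\<epsilon> - A) * trivial_dist (x i) (y i)" for i
    using ab[of i] A[OF occupation_pos occupation_pos, of "x i" "y i" x i y i]
    by (intro ex_particle_coupling \<epsilon>) (auto simp: a_def b_def)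
  then obtain \<pi> where \<pi>: "\<And>i. map_pmf fst (\<pi> i) = P (x i)" "\<And>i. map_pmf snd (\<pi> i) = P (y i)"
    and joint: "\<And>i. min (a i) (b i) * (measure_pmf.expectation (\<pi> i) (\<lambda>w. trivial_dist (fst w) (snd
        w)) - trivial_dist (x i) (y i))
      \<le> (\<epsilon> - A) * trivial_dist (x i) (y i)"
    unfolding couplings_def by simp metis
  \<comment> \<open>For \<open>k = 0\<close> both particles \<open>i\<close> jump together; for
    \<open>k = 1\<close> and \<open>k = 2\<close> the first, respectively the second, jumps alone at
    its excess rate. At most one of the two excess rates is nonzero.\<close>
  define \<rho> where "\<rho> = (\<lambda>(i, k :: nat). if k = 0 then min (a i) (b i) else if k = 1 then a i
      - min (a i) (b i) else b i - min (a i) (b i))"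
  have \<rho>_nonneg: "0 \<le> \<rho> j" for j
    using ab by (cases j) (auto simp: \<rho>_def)
  define \<kappa> where "\<kappa> = (\<lambda>(i, k :: nat).
    if k = 0 then map_pmf (\<lambda>w. (x(i := fst w), y(i := snd w))) (\<pi> i)
    else if k = 1 then map_pmf (\<lambda>u. (x(i := u), y)) (P (x i))
    else map_pmf (\<lambda>v. (x, y(i := v))) (P (y i)))"
  obtain r R where r: "0 \<le> r" and R: "\<And>f. bounded (range f) \<Longrightarrow>
    r * (measure_pmf.expectation R f - f z) = (\<Sum>j\<in>UNIV \<times> {0, 1, 2}. \<rho> j
        * (measure_pmf.expectation (\<kappa> j) f - f z))"
    using ex_pmf_of_rates[of "UNIV \<times> {0, 1, 2}" \<rho> z \<kappa>, OF _ \<rho>_nonneg] by auto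
  have R': "r * (measure_pmf.expectation R f - f (x, y)) = (\<Sum>i\<in>UNIV.
      min (a i) (b i) * (measure_pmf.expectation (\<pi> i) (\<lambda>w. f (x(i := fst w), y(i := snd w))) - f (x, y))
      + (a i - min (a i) (b i)) * (measure_pmf.expectation (P (x i)) (\<lambda>u. f (x(i := u), y)) - f (x, y))
      + (b i - min (a i) (b i)) * (measure_pmf.expectation (P (y i)) (\<lambda>v. f (x, y(i := v))) - f (x, y)))"
    if "bounded (range f)" for f
    unfolding R[OF that, unfolded z] sum.cartesian_product'
    by (simp add: \<rho>_def \<kappa>_def add.assoc)
  \<comment> \<open>For the first copy the rates of \<open>k = 0\<close> and \<open>k = 1\<close>
    add up to \<open>a i\<close>, and the move \<open>k = 2\<close> changes nothing;
    \<open>gen2\<close> is symmetric.\<close>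
  have gen1: "zr_generator c P f (fst z) = r * (measure_pmf.expectation (map_pmf fst R) f - f (fst z))"
    if f: "bounded (range f)" for f
  proof -
    have "measure_pmf.expectation (\<pi> i) (\<lambda>w. f (x(i := fst w)))
        = measure_pmf.expectation (P (x i)) (\<lambda>u. f (x(i := u)))" for i
      unfolding \<pi>(1)[symmetric] by simp
    moreover have "bounded (range (\<lambda>w. f (fst w)))"
      using f by (auto simp: bounded_iff)
    note R'[OF this]
    ultimately show ?thesis
      by (simp add: z zr_generator_expectation[OF f] flip: a_def distrib_right)
  qed
  have gen2: "zr_generator c P f (snd z) = r * (measure_pmf.expectation (map_pmf snd R) f - f (snd z))"
    if f: "bounded (range f)" for f
  proof -
    have "measure_pmf.expectation (\<pi> i) (\<lambda>w. f (y(i := snd w)))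
        = measure_pmf.expectation (P (y i)) (\<lambda>u. f (y(i := u)))" for i
      unfolding \<pi>(2)[symmetric] by simp
    moreover have "bounded (range (\<lambda>w. f (snd w)))"
      using f by (auto simp: bounded_iff)
    note R'[OF this]
    ultimately show ?thesis
      by (simp add: z zr_generator_expectation[OF f] flip: b_def distrib_right)
  qed
  define N where "N = real CARD('n)"
  have N: "0 < N" by (simp add: N_def)
  define \<tau> where "\<tau> i = trivial_dist (x i) (y i)" for i
  define D where "D w = mean_dist trivial_dist (fst w) (snd w)" for w :: "('n \<Rightarrow> 'a) \<times> ('n \<Rightarrow> 'a)"
  have D_upd: "D (x(i := u), y(i := v)) = D (x, y) + (trivial_dist u v - \<tau> i) / N" for i u v
    by (simp add: D_def mean_dist_update \<tau>_def N_def)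
  have D_upd1: "D (x(i := u), y) = D (x, y) + (trivial_dist u (y i) - \<tau> i) / N" for i u
    using D_upd[of i u "y i"] by simp
  have D_upd2: "D (x, y(i := v)) = D (x, y) + (trivial_dist (x i) v - \<tau> i) / N" for i v
    using D_upd[of i "x i" v] by simp
  have affine: "measure_pmf.expectation M (\<lambda>w. D (x, y) + (trivial_dist (g w) (h w) - t) / N) - D (x, y)
      = (measure_pmf.expectation M (\<lambda>w. trivial_dist (g w) (h w)) - t) / N"
    for M :: "'c pmf" and g h :: "'c \<Rightarrow> 'a" and t
  proof -
    have "integrable (measure_pmf M) (\<lambda>w. trivial_dist (g w) (h w))"
      by (intro integrable_pmf_bounded) (auto simp: bounded_iff trivial_dist_def intro!: exI[of _ 1])
    then show ?thesis by simp
  qed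
  define T where "T i =
      min (a i) (b i) * (measure_pmf.expectation (\<pi> i) (\<lambda>w. trivial_dist (fst w) (snd w)) - \<tau> i)
      + (a i - min (a i) (b i)) * (measure_pmf.expectation (P (x i)) (\<lambda>u. trivial_dist u (y i)) - \<tau> i)
      + (b i - min (a i) (b i)) * (measure_pmf.expectation (P (y i)) (\<lambda>v. trivial_dist (x i) v)
          - \<tau> i)" for i
  have D_bounded: "bounded (range D)"
    unfolding D_def by (auto simp: bounded_iff mean_dist_trivial_bounds intro!: exI[of _ 1])
  have "r * (measure_pmf.expectation R D - D (x, y)) = (\<Sum>i\<in>UNIV. T i / N)"
    unfolding R'[OF D_bounded] D_upd D_upd1 D_upd2 affine T_def
    by (simp add: add_divide_distrib)
  then have drift_sum: "r * (measure_pmf.expectation R D - D (x, y)) = (\<Sum>i\<in>UNIV. T i) / N"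
    by (simp add: sum_divide_distrib)
  have "(\<Sum>i\<in>UNIV. T i) \<le> (\<Sum>i\<in>UNIV. (\<epsilon> - A) * \<tau> i + (if x i = y i then (1
      - pmf (P (x i)) (x i)) * \<bar>a i - b i\<bar> else 0))"
  proof (rule sum_mono)
    fix i
    show "T i \<le> (\<epsilon> - A) * \<tau> i + (if x i = y i then (1 - pmf (P (x i)) (x i)) * \<bar>a i - b i\<bar> else 0)"
    proof (cases "x i = y i")
      \<comment> \<open>Matched pair: the joint move contributes at most zero, and the faster
        particle alone splits the pair at rate \<open>\<bar>a i - b i\<bar>\<close> times the
        probability \<open>1 - pmf (P (x i)) (x i)\<close> of leaving the site.\<close>
      case True
      have ind: "trivial_dist u v = 1 - indicator {v} u" "trivial_dist v u = 1
          - indicator {v} u" for u v :: 'a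
        by (auto simp: trivial_dist_def)
      have "measure_pmf.expectation (P v) (\<lambda>u. 1 - indicator {v} u) = 1 - pmf (P v) v" for v
        by (subst Bochner_Integration.integral_diff) (auto simp: pmf.rep_eq
            intro!: integrable_pmf_bounded simp: bounded_iff indicator_def of_bool_def intro!: exI[of _ 1])
      then have E: "measure_pmf.expectation (P v) (\<lambda>u. trivial_dist u v) = 1 - pmf (P v) v"
          "measure_pmf.expectation (P v) (\<lambda>u. trivial_dist v u) = 1 - pmf (P v) v" for v
        unfolding ind(1)[of _ v] ind(2)[of v] by simp_all
      show ?thesis
        using True joint[of i] by (auto simp: T_def \<tau>_def E min_def abs_if algebra_simps)
    next
      \<comment> \<open>Unmatched pair: the distance is already maximal, so moves of one particle
        alone cannot increase it, and the bound for the joint move suffices.\<close>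
      case False
      have le1: "measure_pmf.expectation M (\<lambda>w. trivial_dist (g w) (h w))
          \<le> 1" for M :: "'a pmf" and g h :: "'a \<Rightarrow> 'a"
        by (rule abs_expectation_le[THEN abs_le_D1]) (simp add: trivial_dist_def)
      have "(a i - min (a i) (b i)) * (measure_pmf.expectation (P (x i)) (\<lambda>u. trivial_dist u (y i))
          - \<tau> i) \<le> 0"
          "(b i - min (a i) (b i)) * (measure_pmf.expectation (P (y i)) (\<lambda>v. trivial_dist (x i) v)
              - \<tau> i) \<le> 0"
        using False le1[of "P (x i)" "\<lambda>u. u" "\<lambda>_. y i"] le1[of "P (y i)" "\<lambda>_. x i" "\<lambda>v. v"]
        by (auto simp: \<tau>_def intro!: mult_nonneg_nonpos)
      then show ?thesis
        using False joint[of i] by (simp add: T_def \<tau>_def)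
    qed
  qed
  also have "\<dots> = (\<epsilon> - A) * (\<Sum>i\<in>UNIV. \<tau> i) + (\<Sum>i | x i = y i. (1 - pmf (P (x i)) (x i)) * \<bar>a i - b i\<bar>)"
    by (simp add: sum.distrib sum_distrib_left sum.If_cases)
  also have "\<dots> \<le> (\<epsilon> - A) * (\<Sum>i\<in>UNIV. \<tau> i) + 2 * B * (\<Sum>i\<in>UNIV. \<tau> i)"
    unfolding a_def b_def \<tau>_def
    by (intro add_left_mono matched_rate_difference_le B) (auto simp: pmf_le_1)
  finally have "(\<Sum>i\<in>UNIV. T i) / N \<le> ((\<epsilon> - A) * (\<Sum>i\<in>UNIV. \<tau> i) + 2 * B * (\<Sum>i\<in>UNIV. \<tau> i)) / N"
    using N by (intro divide_right_mono) auto
  also have "\<dots> = - (A - 2 * B - \<epsilon>) * ((\<Sum>i\<in>UNIV. \<tau> i) / N)"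
    using N by (simp add: field_simps)
  also have "(\<Sum>i\<in>UNIV. \<tau> i) / N = D (x, y)"
    by (simp add: D_def mean_dist_def \<tau>_def N_def)
  finally have drift: "r * (measure_pmf.expectation R D - D z) \<le> - (A - 2 * B - \<epsilon>) * D z"
    by (simp add: z drift_sum)
  show ?thesis
    using r gen1 gen2 drift unfolding D_def by blast
qed

theorem corollary4p2:
  fixes P :: "'a::countable \<Rightarrow> 'a pmf"
    and c :: "'a \<Rightarrow> nat \<Rightarrow> real"
    and p :: "real \<Rightarrow> ('n::finite \<Rightarrow> 'a) \<Rightarrow> ('n \<Rightarrow> 'a) pmf"
  assumes c_nonneg: "\<And>x n. 1 \<le> n \<Longrightarrow> 0 \<le> c x n"
    and semigroup: "markov_semigroup p"
    and generator: "has_generator p (zr_generator c P)"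
    and nonexpl: "nonexplosive (zr_generator c P :: (('n \<Rightarrow> 'a) \<Rightarrow> real) \<Rightarrow> ('n \<Rightarrow> 'a) \<Rightarrow> real)"
  shows "coarse_ricci (mean_dist trivial_dist) p \<ge>
      (INF x. INF y. INF n\<in>{1..}. INF m\<in>{1..}.
         ereal (coarse_ricci_along trivial_dist P x y * min (c x n) (c y m)))
      - 2 * (SUP x. SUP n\<in>{1..}. SUP m\<in>{1..}.
         ereal ((1 - pmf (P x) x) * (real n / real m) * \<bar>c x n - c x (n + m)\<bar>))"
    (is "_ \<ge> ?A - 2 * ?B")
proof -
  have A_le: "?A \<le> ereal (coarse_ricci_along trivial_dist P x y * min (c x n) (c y m))"
    if "1 \<le> n" "1 \<le> m" for x y n m
    by (rule INF_lower2[OF UNIV_I[of x]], rule INF_lower2[OF UNIV_I[of y]], rule INF_lower2[of n],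
        use that in simp, rule INF_lower) (use that in simp)
  have B_ge: "ereal ((1 - pmf (P x) x) * (real n / real m) * \<bar>c x n - c x (n + m)\<bar>) \<le> ?B"
    if "1 \<le> n" "1 \<le> m" for x n m
    by (rule SUP_upper2[OF UNIV_I[of x]], rule SUP_upper2[of n], use that in simp, rule SUP_upper)
        (use that in simp)
  have B_nonneg: "0 \<le> ?B"
  proof -
    have "0 \<le> ereal ((1 - pmf (P x) x) * (real 1 / real 1) * \<bar>c x 1 - c x (1 + 1)\<bar>)" for x
      by (simp add: pmf_le_1)
    from order_trans[OF this B_ge[of 1 1]] show ?thesis by simp
  qed
  show ?thesis
  \<comment> \<open>\<open>?A\<close> lies below some real number and \<open>?B\<close> is
    nonnegative, so both are real except when the whole bound is
    \<open>- \<infinity>\<close>.\<close>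
  proof (cases "?A = - \<infinity> \<or> ?B = \<infinity>")
    case True
    then have "?A - 2 * ?B = - \<infinity>"
      using A_le[of 1 1 undefined undefined] B_nonneg by (cases ?A; cases ?B) auto
    then show ?thesis by simp
  next
    case False
    then obtain A B where AB: "?A = ereal A" "?B = ereal B"
      using A_le[of 1 1 undefined undefined] B_nonneg by (cases ?A; cases ?B) auto
    show ?thesis
    \<comment> \<open>The margin \<open>e\<close> absorbs the loss from the nearly optimal particle
      couplings.\<close>
    proof (rule ereal_le_epsilon2)
      fix e :: real assume e: "0 < e"
      define D where "D w = mean_dist trivial_dist (fst w) (snd w)" for w :: "('n \<Rightarrow> 'a) \<times> ('n \<Rightarrow> 'a)"
      have "\<forall>z. \<exists>r R. 0 \<le> r \<and>
        (\<forall>f. bounded (range f) \<longrightarrow> zr_generator c P f (fst z) = r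
            * (measure_pmf.expectation (map_pmf fst R) f - f (fst z))) \<and>
        (\<forall>f. bounded (range f) \<longrightarrow> zr_generator c P f (snd z) = r
            * (measure_pmf.expectation (map_pmf snd R) f - f (snd z))) \<and>
        r * (measure_pmf.expectation R D - D z) \<le> - (A - 2 * B - e) * D z"
        unfolding D_def
        by (intro allI ex_zero_range_coupling c_nonneg e)
           (use A_le B_ge AB in auto)
      then obtain r R where rR: "\<And>z. 0 \<le> r z"
        "\<And>z f. bounded (range f) \<Longrightarrow> zr_generator c P f (fst z)
            = r z * (measure_pmf.expectation (map_pmf fst (R z)) f - f (fst z))"
        "\<And>z f. bounded (range f) \<Longrightarrow> zr_generator c P f (snd z)
            = r z * (measure_pmf.expectation (map_pmf snd (R z)) f - f (snd z))"
        and drift: "\<And>z. r z * (measure_pmf.expectation (R z) D - D z) \<le> - (A - 2 * B - e) * D z"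
        by metis
      interpret jump_coupling p "zr_generator c P" r R
        by unfold_locales (fact semigroup generator nonexpl rR)+
      have "wasserstein (mean_dist trivial_dist) (p t x) (p t y) \<le> ennreal (exp (- (A - 2 * B
          - e) * t) * mean_dist trivial_dist x y)"
        if "0 \<le> t" for t x y
      proof -
        have "bounded (range D)" "0 \<le> D z" for z
          unfolding D_def by (auto simp: bounded_iff mean_dist_trivial_bounds intro!: exI[of _ 1])
        from wasserstein_contraction[OF this drift that, of x y] show ?thesis
          by (simp add: D_def)
      qed
      then have "ereal (A - 2 * B - e) \<le> coarse_ricci (mean_dist trivial_dist) p"
        unfolding coarse_ricci_def by (intro Sup_upper) blast
      then show "?A - 2 * ?B \<le> coarse_ricci (mean_dist trivial_dist) p + ereal e"
        unfolding AB by (cases "coarse_ricci (mean_dist trivial_dist) p") auto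
    qed
  qed
qed

end
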